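(* Let $0<p<1$, $0<q<1$, let $L\ge1$ be an integer, and let $(X_k)_{k\ge0}$ be the perturbed at $L$-extrema random walk with parameters $p,q$ (the walk with finite memory). Let $\Delta_L=(2p-1)\pi(\max)+(2q-1)\pi(\min)$, where $\pi$ is the stationary distribution of the associated increment Markov chain $(Y_k)$ on $\{-1,+1\}^L$ and $\pi(\max)$, $\pi(\min)$ are the $\pi$-probabilities of the sets of local maxima and local minima. Let $f:\{-1,+1\}^L\to\{-1,+1\}$, $f(\eta)=\eta^1$, be the first coordinate. Then, as $n\to\infty$, $$\frac{X_n-n\Delta_L}{\sqrt n}\Longrightarrow\mathcal{N}(0,\sigma^2)$$ in distribution, where $$\sigma^2=\mathrm{Var}_\pi(f(Y_1))+2\lim_{m\to\infty}\sum_{k=1}^{m+1}\mathrm{Cov}_\pi(f(Y_1),f(Y_{k+1})).$$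
   Context: The perturbed at $L$-extrema random walk (finite memory $L$): $(X_k)_{k\ge0}$ is a nearest-neighbour process on $\mathbb{Z}$ (each step is $\pm1$) such that, conditionally on the history $X_0,\dots,X_k$ with $X_k=x$, the probability that $X_{k+1}=x+1$ equals $p$ if $x=\max_{0\le m\le L\wedge k}X_{k-m}$, equals $q$ if $x=\min_{0\le m\le L\wedge k}X_{k-m}$, and equals $\tfrac12$ otherwise; $X_{k+1}=x-1$ with the complementary probability. If $x$ is both the maximum and the minimum (which happens only at $k=0$), the probability is $\tfrac12$. Increment chain: $Y_k=(\eta_k^1,\dots,\eta_k^L)$ with $\eta_k^i=X_{k-i+1}-X_{k-i}$, $i=1,\dots,L$, records the last $L$ increments of the walk and is a Markov chain on $\{-1,+1\}^L$. For $\eta=(\eta^1,\dots,\eta^L)$ put $S(\eta,j)=\eta^1+\dots+\eta^j$; $\eta$ is a local maximum if $S(\eta,j)\ge0$ for all $j=1,\dots,L$, a local minimum if $S(\eta,j)\le0$ for all $j=1,\dots,L$, and "neither" otherwise. From $(\eta^1,\dots,\eta^L)$ the chain moves to $(\eta_*,\eta^1,\dots,\eta^{L-1})$, where $\eta_*=+1$ with probability $p$, $q$ or $\tfrac12$ according to whether $\eta$ is a local maximum, a local minimum, or neither, and $\eta_*=-1$ otherwise. The chain is irreducible on a finite state space; $\pi$ denotes its unique stationary distribution, $\pi(\max)=\sum_{\eta\text{ local max}}\pi(\eta)$, $\pi(\min)=\sum_{\eta\text{ local min}}\pi(\eta)$. $\mathrm{Var}_\pi$ and $\mathrm{Cov}_\pi$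 refer to the stationary version of the Markov chain with these transition probabilities, i.e. $(Y_k)_{k\ge1}$ with $Y_1\sim\pi$. *)

theory Defs
  imports "HOL-Probability.Probability"
begin

(* The window is {0..min L k}, so x k is both its maximum and its minimum only when k = 0
   (for L >= 1 and a nearest-neighbour path x). *)
definition up_prob :: "nat \<Rightarrow> real \<Rightarrow> real \<Rightarrow> (nat \<Rightarrow> int) \<Rightarrow> nat \<Rightarrow> real" where
  "up_prob L p q x k =
     (let W = (\<lambda>m. x (k - m)) ` {0..min L k} in
      if x k = Max W \<and> x k = Min W then 1/2
      else if x k = Max W then p
      else if x k = Min W then q
      else 1/2)"

(* The law of X 0 is left arbitrary. *)
locale perturbed_walk = prob_space M for M :: "'a measure" +
  fixes L :: nat and p q :: real and X :: "nat \<Rightarrow> 'a \<Rightarrow> int"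
  assumes X_measurable: "\<And>k. X k \<in> measurable M (count_space UNIV)"
    and step_up: "\<And>k x. prob {\<omega> \<in> space M. \<forall>i\<le>k. X i \<omega> = x i} > 0 \<Longrightarrow>
      \<P>(\<omega> in M. X (Suc k) \<omega> = x k + 1 \<bar> \<forall>i\<le>k. X i \<omega> = x i) = up_prob L p q x k"
    and step_down: "\<And>k x. prob {\<omega> \<in> space M. \<forall>i\<le>k. X i \<omega> = x i} > 0 \<Longrightarrow>
      \<P>(\<omega> in M. X (Suc k) \<omega> = x k - 1 \<bar> \<forall>i\<le>k. X i \<omega> = x i) = 1 - up_prob L p q x k"

(* A state (eta^1, ..., eta^L) is the list [eta^1, ..., eta^L], most recent increment first. *)
definition incr_states :: "nat \<Rightarrow> int list set" where
  "incr_states L = {\<eta>. length \<eta> = L \<and> set \<eta> \<subseteq> {-1, 1}}"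

definition partial_sum :: "int list \<Rightarrow> nat \<Rightarrow> int" where
  "partial_sum \<eta> j = sum_list (take j \<eta>)"

definition local_max :: "int list \<Rightarrow> bool" where
  "local_max \<eta> \<longleftrightarrow> (\<forall>j\<in>{1..length \<eta>}. partial_sum \<eta> j \<ge> 0)"

definition local_min :: "int list \<Rightarrow> bool" where
  "local_min \<eta> \<longleftrightarrow> (\<forall>j\<in>{1..length \<eta>}. partial_sum \<eta> j \<le> 0)"

definition incr_up_prob :: "real \<Rightarrow> real \<Rightarrow> int list \<Rightarrow> real" where
  "incr_up_prob p q \<eta> = (if local_max \<eta> then p else if local_min \<eta> then q else 1/2)"

definition incr_kernel :: "real \<Rightarrow> real \<Rightarrow> int list \<Rightarrow> int list pmf" where
  "incr_kernel p q \<eta> =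
     map_pmf (\<lambda>up. (if up then 1 else -1) # butlast \<eta>) (bernoulli_pmf (incr_up_prob p q \<eta>))"

definition stationary_distribution :: "nat \<Rightarrow> real \<Rightarrow> real \<Rightarrow> int list pmf \<Rightarrow> bool" where
  "stationary_distribution L p q \<pi> \<longleftrightarrow>
     set_pmf \<pi> \<subseteq> incr_states L \<and> bind_pmf \<pi> (incr_kernel p q) = \<pi>"

definition drift :: "real \<Rightarrow> real \<Rightarrow> int list pmf \<Rightarrow> real" where
  "drift p q \<pi> = (2 * p - 1) * measure_pmf.prob \<pi> {\<eta>. local_max \<eta>}
               + (2 * q - 1) * measure_pmf.prob \<pi> {\<eta>. local_min \<eta>}"

(* The time index of Y starts at 1; Y 0 plays no role. *)
locale increment_chain = prob_space N for N :: "'b measure" +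
  fixes p q :: real and init :: "int list pmf" and Y :: "nat \<Rightarrow> 'b \<Rightarrow> int list"
  assumes Y_measurable: "\<And>k. k \<ge> 1 \<Longrightarrow> Y k \<in> measurable N (count_space UNIV)"
    and initial: "\<And>\<eta>. prob {\<omega> \<in> space N. Y 1 \<omega> = \<eta>} = pmf init \<eta>"
    and transition: "\<And>k y \<eta>. k \<ge> 1 \<Longrightarrow>
      prob {\<omega> \<in> space N. \<forall>i\<in>{1..k}. Y i \<omega> = y i} > 0 \<Longrightarrow>
      \<P>(\<omega> in N. Y (Suc k) \<omega> = \<eta> \<bar> \<forall>i\<in>{1..k}. Y i \<omega> = y i) = pmf (incr_kernel p q (y k)) \<eta>"

definition first_coord :: "int list \<Rightarrow> real" where
  "first_coord \<eta> = real_of_int (hd \<eta>)"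

definition covariance_of :: "'a measure \<Rightarrow> ('a \<Rightarrow> real) \<Rightarrow> ('a \<Rightarrow> real) \<Rightarrow> real" where
  "covariance_of N A B =
     (LINT \<omega>|N. (A \<omega> - (LINT \<omega>'|N. A \<omega>')) * (B \<omega> - (LINT \<omega>'|N. B \<omega>')))"

(* N(0, v) for v >= 0. In the library normal_density takes the standard deviation, and
   normal_density 0 0 is identically zero, so the point mass for v = 0 is added by hand. *)
definition centered_normal :: "real \<Rightarrow> real measure" where
  "centered_normal v =
     (if v = 0 then return borel 0 else density lborel (normal_density 0 (sqrt v)))"

end

theory Submission
  imports Defs "HOL-Real_Asymp.Real_Asymp"
begin

text \<open>
  Nagaev--Guivarc'h perturbation, made elementary. Let \<open>P\<close> be the transition operator of the increment
  chain, \<open>f\<close> the centred first coordinate and \<open>Q\<^sub>s w = P (exp(i s f) w)\<close>. Since \<open>P^L\<close> has strictly positive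
  entries, \<open>P\<close> contracts oscillations geometrically, so the Poisson equations \<open>g - P g = P f\<close> and
  \<open>h - P h = \<sigma>\<^sup>2/2 - P (f\<^sup>2/2 + f g)\<close> are solvable; the second right-hand side has mean zero exactly
  because \<open>\<sigma>\<^sup>2 = \<pi>(f\<^sup>2) + 2 \<pi>(f g)\<close>. Then \<open>w = 1 + i s g + s\<^sup>2 h\<close> satisfies
  \<open>Q\<^sub>s w = (1 - \<sigma>\<^sup>2 s\<^sup>2/2) w + O(s\<^sup>3)\<close>. Iterating \<open>n\<close> times with \<open>s = t/\<surd>n\<close>, the characteristic function
  of the normalised walk tends to \<open>exp(-\<sigma>\<^sup>2 t\<^sup>2/2)\<close>, and Levy's continuity theorem applies.
  Nonnegativity of \<open>\<sigma>\<^sup>2\<close> comes for free, as limits of characteristic functions are bounded by 1.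
\<close>

section \<open>Laws of histories of discrete processes\<close>

text \<open>Histories are listed with the most recent value first, as the states in \<open>incr_states\<close> are.\<close>
primrec history :: "(nat \<Rightarrow> 'a \<Rightarrow> 's) \<Rightarrow> nat \<Rightarrow> 'a \<Rightarrow> 's list" where
  "history Z 0 \<omega> = [Z 0 \<omega>]"
| "history Z (Suc k) \<omega> = Z (Suc k) \<omega> # history Z k \<omega>"

text \<open>The kernel sees the whole past, so one construction serves both the walk, whose next
  step depends on a window of positions, and the increment chain, whose kernel looks at
  \<open>hd l\<close> only.\<close>

primrec history_pmf :: "'s pmf \<Rightarrow> ('s list \<Rightarrow> 's pmf) \<Rightarrow> nat \<Rightarrow> 's list pmf" where
  "history_pmf \<mu> K 0 = map_pmf (\<lambda>z. [z]) \<mu>"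
| "history_pmf \<mu> K (Suc k) =
     bind_pmf (history_pmf \<mu> K k) (\<lambda>l. map_pmf (\<lambda>z. z # l) (K l))"

lemma length_history [simp]: "length (history Z k \<omega>) = Suc k"
  by (induction k) auto

lemma nth_history: "i \<le> k \<Longrightarrow> history Z k \<omega> ! i = Z (k - i) \<omega>"
  by (induction k arbitrary: i) (auto simp: nth_Cons split: nat.split)

lemma history_eq_iff:
  assumes "length l = Suc k"
  shows "history Z k \<omega> = l \<longleftrightarrow> (\<forall>i\<le>k. Z i \<omega> = l ! (k - i))"
proof
  assume "history Z k \<omega> = l"
  then show "\<forall>i\<le>k. Z i \<omega> = l ! (k - i)" by (auto simp: nth_history)
next
  assume *: "\<forall>i\<le>k. Z i \<omega> = l ! (k - i)"
  show "history Z k \<omega> = l"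
  proof (rule nth_equalityI)
    fix i assume "i < length (history Z k \<omega>)"
    then have "i \<le> k" by simp
    then show "history Z k \<omega> ! i = l ! i" using *[rule_format, of "k - i"] by (simp add: nth_history)
  qed (use assms in simp)
qed

lemma measurable_history [measurable]:
  fixes Z :: "nat \<Rightarrow> 'a \<Rightarrow> 's :: countable"
  assumes Z [measurable]: "\<And>k. Z k \<in> measurable M (count_space UNIV)"
  shows "history Z k \<in> measurable M (count_space UNIV)"
proof (induction k)
  case 0
  have "(\<lambda>\<omega>. [Z 0 \<omega>]) \<in> measurable M (count_space UNIV)" by measurable
  then show ?case by (simp cong: measurable_cong)
next
  case (Suc k)
  note Suc [measurable]
  have "(\<lambda>\<omega>. Z (Suc k) \<omega> # history Z k \<omega>) \<in> measurable M (count_space UNIV)" by measurable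
  then show ?case by (simp cong: measurable_cong)
qed

lemma length_set_history_pmf: "l \<in> set_pmf (history_pmf \<mu> K k) \<Longrightarrow> length l = Suc k"
  by (induction k arbitrary: l) auto

lemma finite_set_history_pmf:
  assumes "finite (set_pmf \<mu>)" "\<And>l. finite (set_pmf (K l))"
  shows "finite (set_pmf (history_pmf \<mu> K k))"
  by (induction k) (auto simp: assms)

lemma pmf_history_Nil: "pmf (history_pmf \<mu> K k) [] = 0"
  using length_set_history_pmf[of "[]" \<mu> K k] by (auto simp: set_pmf_iff)

lemma pmf_history_Suc:
  "pmf (history_pmf \<mu> K (Suc k)) (z # l) = pmf (history_pmf \<mu> K k) l * pmf (K l) z"
proof -
  have "pmf (map_pmf (\<lambda>z. z # l') (K l')) (z # l) = pmf (K l) z * indicator {l} l'" for l'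
  proof (cases "l' = l")
    case True
    then show ?thesis using pmf_map_inj'[of "\<lambda>z. z # l" "K l" z] by (simp add: inj_def)
  next
    case False
    then show ?thesis by (auto simp: pmf_eq_0_set_pmf)
  qed
  then show ?thesis by (simp add: pmf_bind measure_pmf_single)
qed

text \<open>Point probabilities of histories obey the recursion \<open>pmf_history_Suc\<close>, and
  on a countable type they determine the law. The hypothesis \<open>step\<close> is silent after a
  history of probability 0, but there both sides vanish by monotonicity.\<close>

lemma (in prob_space) distr_history:
  fixes Z :: "nat \<Rightarrow> 'a \<Rightarrow> 's :: countable"
  assumes Z [measurable]: "\<And>k. Z k \<in> measurable M (count_space UNIV)"
    and init: "\<And>z. prob {\<omega> \<in> space M. Z 0 \<omega> = z} = pmf \<mu> z"
    and step: "\<And>k l z. length l = Suc k \<Longrightarrow> prob {\<omega> \<in> space M. history Z k \<omega> = l} > 0 \<Longrightarrow>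
      prob {\<omega> \<in> space M. Z (Suc k) \<omega> = z \<and> history Z k \<omega> = l}
        = pmf (K l) z * prob {\<omega> \<in> space M. history Z k \<omega> = l}"
  shows "distr M (count_space UNIV) (history Z k) = measure_pmf (history_pmf \<mu> K k)"
proof -
  note [measurable] = measurable_history[OF Z]
  have *: "prob {\<omega> \<in> space M. history Z k \<omega> = l} = pmf (history_pmf \<mu> K k) l" for l
  proof (induction k arbitrary: l)
    case 0
    show ?case
    proof (cases "\<exists>z. l = [z]")
      case True
      then obtain z where "l = [z]" ..
      then show ?thesis using pmf_map_inj'[of "\<lambda>z. [z]" \<mu> z] init[of z] by (simp add: inj_def)
    next
      case False
      then have "l \<notin> set_pmf (history_pmf \<mu> K 0)" "{\<omega> \<in> space M. history Z 0 \<omega> = l} = {}" by auto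
      then show ?thesis by (simp only: pmf_eq_0_set_pmf[symmetric] measure_empty)
    qed
  next
    case (Suc k)
    show ?case
    proof (cases l)
      case Nil
      then show ?thesis using pmf_history_Nil[of \<mu> K "Suc k"] by simp
    next
      case (Cons z l')
      have eq: "{\<omega> \<in> space M. history Z (Suc k) \<omega> = l}
          = {\<omega> \<in> space M. Z (Suc k) \<omega> = z \<and> history Z k \<omega> = l'}"
        by (auto simp: Cons)
      show ?thesis
      proof (cases "prob {\<omega> \<in> space M. history Z k \<omega> = l'} = 0")
        case True
        have "prob {\<omega> \<in> space M. Z (Suc k) \<omega> = z \<and> history Z k \<omega> = l'} \<le> prob {\<omega> \<in> space M. history Z k \<omega> = l'}"
          by (intro finite_measure_mono) auto
        with True have "prob {\<omega> \<in> space M. history Z (Suc k) \<omega> = l} = 0"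
          unfolding eq using measure_nonneg by (metis antisym)
        with True show ?thesis unfolding Cons pmf_history_Suc by (simp add: Suc.IH)
      next
        case False
        then have pos: "prob {\<omega> \<in> space M. history Z k \<omega> = l'} > 0" by (simp add: zero_less_measure_iff)
        with Suc.IH[of l'] have "length l' = Suc k"
          by (intro length_set_history_pmf[of l' \<mu> K k]) (simp add: set_pmf_iff)
        from step[OF this pos] show ?thesis
          unfolding eq unfolding Cons pmf_history_Suc by (simp add: Suc.IH)
      qed
    qed
  qed
  show ?thesis
  proof (rule measure_eqI_countable[of _ UNIV])
    fix l
    have "emeasure (distr M (count_space UNIV) (history Z k)) {l} = prob {\<omega> \<in> space M. history Z k \<omega> = l}"
      by (subst emeasure_distr) (auto simp: emeasure_eq_measure vimage_def Int_def conj_commute)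
    then show "emeasure (distr M (count_space UNIV) (history Z k)) {l} = emeasure (measure_pmf (history_pmf \<mu> K k)) {l}"
      by (simp add: * emeasure_pmf_single)
  qed auto
qed

text \<open>Supplies the unspecified law of \<open>X 0\<close> as a pmf.\<close>

lemma (in prob_space) pmf_of_countable_rv:
  fixes Z :: "'a \<Rightarrow> 's :: countable"
  assumes [measurable]: "Z \<in> measurable M (count_space UNIV)"
  obtains \<mu> where "\<And>z. prob {\<omega> \<in> space M. Z \<omega> = z} = pmf \<mu> z"
proof
  let ?D = "distr M (count_space UNIV) Z"
  interpret D: prob_space ?D by (rule prob_space_distr) simp
  have "AE x in ?D. measure ?D {x} \<noteq> 0"
    by (subst D.AE_support_countable) (auto intro!: exI[of _ UNIV])
  then have D: "measure_pmf (Abs_pmf ?D) = ?D"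
    by (intro Abs_pmf_inverse) (auto intro: D.prob_space_axioms)
  fix z
  have "pmf (Abs_pmf ?D) z = measure ?D {z}" by (metis D measure_pmf_single)
  also have "\<dots> = prob {\<omega> \<in> space M. Z \<omega> = z}"
    by (subst measure_distr) (auto simp: vimage_def Int_def conj_commute)
  finally show "prob {\<omega> \<in> space M. Z \<omega> = z} = pmf (Abs_pmf ?D) z" ..
qed

lemma integral_bind_pmf_bounded_real:
  fixes h :: "'b \<Rightarrow> real"
  assumes "\<And>x. \<bar>h x\<bar> \<le> B"
  shows "measure_pmf.expectation (bind_pmf \<mu> K) h
      = measure_pmf.expectation \<mu> (\<lambda>x. measure_pmf.expectation (K x) h)"
  unfolding measure_pmf_bind
  by (rule integral_bind[where K = "count_space UNIV" and B' = 1 and B = B])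
     (use assms in \<open>auto simp: measure_pmf.emeasure_space_1 measure_pmf_in_subprob_algebra measure_pmf.finite_measure_axioms\<close>)

lemma norm_expectation_pmf_le:
  fixes f :: "'a \<Rightarrow> complex"
  assumes "\<And>x. x \<in> set_pmf \<mu> \<Longrightarrow> norm (f x) \<le> B"
  shows "norm (measure_pmf.expectation \<mu> f) \<le> B"
proof -
  have int: "integrable (measure_pmf \<mu>) f"
    by (rule measure_pmf.integrable_const_bound[where B = B]) (auto simp: assms AE_measure_pmf_iff)
  have "norm (measure_pmf.expectation \<mu> f) \<le> measure_pmf.expectation \<mu> (\<lambda>x. norm (f x))"
    by (rule integral_norm_bound)
  also have "\<dots> \<le> B"
    by (rule measure_pmf.integral_le_const) (auto simp: assms int AE_measure_pmf_iff)
  finally show ?thesis .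
qed

text \<open>\<open>X 0\<close> may have infinite support, so expectations over walk histories need
  not be finite sums; boundedness takes the place of finiteness. The real case is applied to real
  and imaginary parts.\<close>

lemma integral_bind_pmf_bounded:
  fixes h :: "'b \<Rightarrow> complex"
  assumes "\<And>x. norm (h x) \<le> B"
  shows "measure_pmf.expectation (bind_pmf \<mu> K) h
      = measure_pmf.expectation \<mu> (\<lambda>x. measure_pmf.expectation (K x) h)"
proof -
  have int: "integrable (measure_pmf \<nu>) h" for \<nu>
    by (rule measure_pmf.integrable_const_bound[where B = B]) (auto simp: assms)
  have "norm (measure_pmf.expectation \<nu> h) \<le> B" for \<nu>
    by (rule norm_expectation_pmf_le) (rule assms)
  then have int': "integrable (measure_pmf \<mu>) (\<lambda>x. measure_pmf.expectation (K x) h)"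
    by (intro measure_pmf.integrable_const_bound[where B = B]) auto
  have "\<bar>Re (h x)\<bar> \<le> B" "\<bar>Im (h x)\<bar> \<le> B" for x
    using assms[of x] abs_Re_le_cmod[of "h x"] abs_Im_le_cmod[of "h x"] by linarith+
  then show ?thesis
    by (intro complex_eqI)
       (simp_all add: int int' integral_bind_pmf_bounded_real[where B = B] flip: integral_Re integral_Im)
qed

section \<open>The transition operator of the increment chain\<close>

text \<open>The explicit two-term sum makes linearity and limits a matter of algebra;
  \<open>expectation_incr_kernel\<close> identifies it with the expectation under the
  kernel.\<close>

definition incr_op :: "real \<Rightarrow> real \<Rightarrow> (int list \<Rightarrow> real) \<Rightarrow> int list \<Rightarrow> real" where
  "incr_op p q \<phi> \<eta> = incr_up_prob p q \<eta> * \<phi> (1 # butlast \<eta>)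
                     + (1 - incr_up_prob p q \<eta>) * \<phi> (- 1 # butlast \<eta>)"

text \<open>A lower bound for every one-step probability, up or down, in all three kinds of
  state.\<close>

definition step_bound :: "real \<Rightarrow> real \<Rightarrow> real" where
  "step_bound p q = Min {p, 1 - p, q, 1 - q, 1/2}"

text \<open>Contraction will gain a factor only once in \<open>L\<close> steps. With
  \<open>\<rho>\<close> the \<open>L\<close>-th root of \<open>r\<close>, the inequality
  \<open>k \<le> L * Suc (k div L)\<close> gives domination by a geometric series of ratio
  \<open>\<rho>\<close>.\<close>

lemma summable_power_div:
  fixes r :: real and L :: nat
  assumes "0 < r" "r < 1" and L: "L \<ge> 1"
  shows "summable (\<lambda>k. r ^ (k div L))"
proof (rule summable_comparison_test')
  define \<rho> where "\<rho> = root L r"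
  have \<rho>: "0 < \<rho>" "\<rho> < 1" "\<rho> ^ L = r" using assms L by (auto simp: \<rho>_def)
  show "summable (\<lambda>k. inverse r * \<rho> ^ k)" using \<rho> by (intro summable_mult summable_geometric) auto
  fix k :: nat
  have "k \<le> L * Suc (k div L)" using L dividend_less_times_div[of L k] by simp
  then have "\<rho> ^ (L * Suc (k div L)) \<le> \<rho> ^ k" using \<rho> by (intro power_decreasing) auto
  then have "r * r ^ (k div L) \<le> \<rho> ^ k" by (simp only: power_mult \<rho> power_Suc)
  then show "norm (r ^ (k div L)) \<le> inverse r * \<rho> ^ k" using assms by (simp add: field_simps)
qed

lemma finite_incr_states [simp]: "finite (incr_states L)"
  using finite_lists_length_eq[of "{-1, 1::int}" L]
  by (simp add: incr_states_def conj_commute)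

lemma Cons_butlast_in_incr_states:
  assumes "\<eta> \<in> incr_states L" "L \<ge> 1" "b = 1 \<or> b = - 1"
  shows "b # butlast \<eta> \<in> incr_states L"
  using assms by (auto simp: incr_states_def dest: in_set_butlastD)

text \<open>The two weights add up to 1, so constants are fixed. Hence bounds for nonnegative
  functions can be applied to \<open>\<phi> - a\<close> and \<open>a + d - \<phi>\<close>.\<close>

lemma funpow_incr_op_affine:
  "(incr_op p q ^^ k) (\<lambda>\<eta>. a * \<phi> \<eta> + c) = (\<lambda>\<eta>. a * (incr_op p q ^^ k) \<phi> \<eta> + c)"
proof (induction k)
  case (Suc k)
  show ?case
    unfolding funpow.simps comp_def Suc.IH by (auto simp: incr_op_def algebra_simps)
qed simp

lemma set_pmf_incr_kernel:
  "set_pmf (incr_kernel p q \<eta>) \<subseteq> {1 # butlast \<eta>, - 1 # butlast \<eta>}"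
  by (auto simp: incr_kernel_def)

lemma finite_set_pmf_incr_kernel [simp]: "finite (set_pmf (incr_kernel p q \<eta>))"
  by (rule finite_subset[OF set_pmf_incr_kernel]) simp

locale incr_params =
  fixes p q :: real and L :: nat
  assumes p: "0 < p" "p < 1" and q: "0 < q" "q < 1" and L: "L \<ge> 1"
begin

abbreviation "S \<equiv> incr_states L"
abbreviation "P \<equiv> incr_op p q"
abbreviation "\<delta> \<equiv> step_bound p q"

lemma step_bound_pos: "0 < \<delta>"
  and step_bound_le: "\<delta> \<le> incr_up_prob p q \<eta>" "\<delta> \<le> 1 - incr_up_prob p q \<eta>"
  using p q by (auto simp: step_bound_def incr_up_prob_def min_def)

lemma incr_up_prob_bounds: "0 \<le> incr_up_prob p q \<eta>" "incr_up_prob p q \<eta> \<le> 1"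
  using step_bound_le[of \<eta>] step_bound_pos by linarith+

lemma step_bound_less_1: "\<delta> < 1"
  using step_bound_le[of undefined] step_bound_pos by linarith

lemma expectation_incr_kernel:
  "measure_pmf.expectation (incr_kernel p q \<eta>) \<phi> = P \<phi> \<eta>"
  using incr_up_prob_bounds[of \<eta>] by (simp add: incr_kernel_def incr_op_def)

lemma incr_op_ge:
  assumes "\<And>\<zeta>. \<zeta> \<in> S \<Longrightarrow> a \<le> \<phi> \<zeta>" "\<eta> \<in> S"
  shows "a \<le> P \<phi> \<eta>"
proof -
  have "a = incr_up_prob p q \<eta> * a + (1 - incr_up_prob p q \<eta>) * a" by (simp add: algebra_simps)
  also have "\<dots> \<le> P \<phi> \<eta>" unfolding incr_op_def
    using incr_up_prob_bounds[of \<eta>] assms L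
    by (intro add_mono mult_left_mono) (auto intro!: assms(1) Cons_butlast_in_incr_states)
  finally show ?thesis .
qed

lemma funpow_incr_op_ge:
  assumes "\<And>\<zeta>. \<zeta> \<in> S \<Longrightarrow> a \<le> \<phi> \<zeta>" "\<eta> \<in> S"
  shows "a \<le> (P ^^ k) \<phi> \<eta>"
  using assms(2) by (induction k arbitrary: \<eta>) (auto intro!: assms(1) incr_op_ge)

lemma funpow_incr_op_le:
  assumes "\<And>\<zeta>. \<zeta> \<in> S \<Longrightarrow> \<phi> \<zeta> \<le> a" "\<eta> \<in> S"
  shows "(P ^^ k) \<phi> \<eta> \<le> a"
  using funpow_incr_op_ge[of "-a" "\<lambda>\<eta>. - 1 * \<phi> \<eta> + 0" \<eta> k] assms
  unfolding funpow_incr_op_affine by simp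

section \<open>Doeblin minorization and contraction of oscillations\<close>

lemma incr_op_minorization:
  assumes nonneg: "\<And>\<zeta>. \<zeta> \<in> S \<Longrightarrow> 0 \<le> \<psi> \<zeta>" and "\<eta> \<in> S" "b = 1 \<or> b = - 1"
  shows "\<delta> * \<psi> (b # butlast \<eta>) \<le> P \<psi> \<eta>"
proof -
  have "0 \<le> \<psi> (1 # butlast \<eta>)" "0 \<le> \<psi> (- 1 # butlast \<eta>)"
    using assms L by (auto intro!: nonneg Cons_butlast_in_incr_states)
  then have "\<delta> * \<psi> (1 # butlast \<eta>) \<le> incr_up_prob p q \<eta> * \<psi> (1 # butlast \<eta>)"
    "\<delta> * \<psi> (- 1 # butlast \<eta>) \<le> (1 - incr_up_prob p q \<eta>) * \<psi> (- 1 # butlast \<eta>)"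
    "0 \<le> \<delta> * \<psi> (1 # butlast \<eta>)" "0 \<le> \<delta> * \<psi> (- 1 # butlast \<eta>)"
    using step_bound_le[of \<eta>] step_bound_pos by (auto intro!: mult_right_mono mult_nonneg_nonneg)
  with assms(3) show ?thesis unfolding incr_op_def by auto
qed

text \<open>Keep only the path that makes the increments \<open>bs\<close>; each of its steps has
  probability at least \<open>\<delta>\<close>. The last entry of \<open>bs\<close> is the earliest
  step, hence the induction from the right.\<close>

lemma funpow_incr_op_minorization:
  assumes nonneg: "\<And>\<zeta>. \<zeta> \<in> S \<Longrightarrow> 0 \<le> \<psi> \<zeta>"
    and "\<eta> \<in> S" "length bs \<le> L" "set bs \<subseteq> {-1, 1}"
  shows "\<delta> ^ length bs * \<psi> (bs @ take (L - length bs) \<eta>) \<le> (P ^^ length bs) \<psi> \<eta>"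
  using assms(2-)
proof (induction bs arbitrary: \<eta> rule: rev_induct)
  case Nil
  then show ?case by (simp add: incr_states_def)
next
  case (snoc b bs)
  let ?\<eta> = "b # butlast \<eta>"
  have S: "?\<eta> \<in> S" using snoc.prems L by (auto intro!: Cons_butlast_in_incr_states)
  have "take (L - length bs) ?\<eta> = b # take (L - length (bs @ [b])) \<eta>"
    using snoc.prems by (simp add: take_Cons' take_butlast incr_states_def)
  then have "\<delta> ^ length bs * \<psi> ((bs @ [b]) @ take (L - length (bs @ [b])) \<eta>) \<le> (P ^^ length bs) \<psi> ?\<eta>"
    using snoc.IH[OF S] snoc.prems by simp
  then have "\<delta> ^ length (bs @ [b]) * \<psi> ((bs @ [b]) @ take (L - length (bs @ [b])) \<eta>)
      \<le> \<delta> * (P ^^ length bs) \<psi> ?\<eta>"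
    using step_bound_pos by (simp add: mult.assoc)
  also have "\<dots> \<le> P ((P ^^ length bs) \<psi>) \<eta>"
    using snoc.prems by (intro incr_op_minorization) (auto intro!: funpow_incr_op_ge nonneg)
  finally show ?case by simp
qed

text \<open>After \<open>L\<close> steps the old state has been pushed out of the list entirely, so
  the previous bound with \<open>bs = \<zeta>\<close> no longer involves \<open>\<eta>\<close> on
  the left.\<close>

lemma doeblin_minorization:
  assumes "\<And>\<zeta>. \<zeta> \<in> S \<Longrightarrow> 0 \<le> \<psi> \<zeta>" "\<eta> \<in> S" "\<zeta> \<in> S"
  shows "\<delta> ^ L * \<psi> \<zeta> \<le> (P ^^ L) \<psi> \<eta>"
  using funpow_incr_op_minorization[of \<psi> \<eta> \<zeta>] assms(1,2) assms(3) by (simp add: incr_states_def)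

text \<open>Oscillation is bounded through an enclosing interval, because averaging keeps values
  inside such an interval.\<close>

definition osc_within :: "(int list \<Rightarrow> real) \<Rightarrow> real \<Rightarrow> bool" where
  "osc_within \<phi> d \<longleftrightarrow> (\<exists>a. \<forall>\<eta>\<in>S. a \<le> \<phi> \<eta> \<and> \<phi> \<eta> \<le> a + d)"

lemma osc_within_exists: "\<exists>d. osc_within \<phi> d"
proof -
  define B where "B = Max (insert 0 ((\<lambda>\<eta>. \<bar>\<phi> \<eta>\<bar>) ` S))"
  have B: "\<bar>\<phi> \<eta>\<bar> \<le> B" if "\<eta> \<in> S" for \<eta>
    unfolding B_def using that by (intro Max_ge) auto
  have "- B \<le> \<phi> \<eta> \<and> \<phi> \<eta> \<le> - B + 2 * B" if "\<eta> \<in> S" for \<eta>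
    using B[OF that] by linarith
  then have "osc_within \<phi> (2 * B)" unfolding osc_within_def by (intro exI[of _ "- B"] ballI)
  then show ?thesis ..
qed

lemma osc_within_funpow: "osc_within \<phi> d \<Longrightarrow> osc_within ((P ^^ k) \<phi>) d"
  unfolding osc_within_def by (metis funpow_incr_op_ge funpow_incr_op_le)

text \<open>Minorization at one state \<open>\<zeta>\<close>, applied to \<open>\<phi> - a\<close>
  and to \<open>a + d - \<phi>\<close>, raises the lower end and lowers the upper end of the
  interval. The two gains add up to \<open>\<delta> ^ L * d\<close> whatever
  \<open>\<phi> \<zeta>\<close> is.\<close>

lemma osc_within_doeblin:
  assumes "osc_within \<phi> d"
  shows "osc_within ((P ^^ L) \<phi>) ((1 - \<delta> ^ L) * d)"
proof -
  obtain a where a: "\<And>\<eta>. \<eta> \<in> S \<Longrightarrow> a \<le> \<phi> \<eta>" "\<And>\<eta>. \<eta> \<in> S \<Longrightarrow> \<phi> \<eta> \<le> a + d"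
    using assms unfolding osc_within_def by blast
  \<comment> \<open>Any fixed state would serve.\<close>
  define \<zeta> where "\<zeta> = replicate L (1::int)"
  have \<zeta>: "\<zeta> \<in> S" by (auto simp: \<zeta>_def incr_states_def)
  have "a + \<delta> ^ L * (\<phi> \<zeta> - a) \<le> (P ^^ L) \<phi> \<eta>"
    and "(P ^^ L) \<phi> \<eta> \<le> a + d - \<delta> ^ L * (a + d - \<phi> \<zeta>)" if "\<eta> \<in> S" for \<eta>
    using doeblin_minorization[OF _ that \<zeta>, where \<psi> = "\<lambda>\<eta>. 1 * \<phi> \<eta> + - a"]
      doeblin_minorization[OF _ that \<zeta>, where \<psi> = "\<lambda>\<eta>. - 1 * \<phi> \<eta> + (a + d)"] a
    unfolding funpow_incr_op_affine by auto
  then show ?thesis unfolding osc_within_def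
    by (intro exI[of _ "a + \<delta> ^ L * (\<phi> \<zeta> - a)"]) (simp add: algebra_simps)
qed

text \<open>Each full block of \<open>L\<close> steps contracts; the remaining
  \<open>k mod L\<close> steps do not increase the oscillation.\<close>

lemma osc_within_geometric:
  assumes "osc_within \<phi> d"
  shows "osc_within ((P ^^ k) \<phi>) ((1 - \<delta> ^ L) ^ (k div L) * d)"
proof -
  have "osc_within ((P ^^ (L * m)) \<phi>) ((1 - \<delta> ^ L) ^ m * d)" for m
  proof (induction m)
    case (Suc m)
    from osc_within_doeblin[OF this] show ?case by (simp add: funpow_add mult.assoc)
  qed (use assms in simp)
  from osc_within_funpow[OF this, of "k mod L" "k div L"] show ?thesis
    by (simp add: funpow_add[of "k mod L" "L * (k div L)" P, THEN fun_cong, symmetric, unfolded comp_def])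
qed

section \<open>Stationary averages, Poisson equations and covariances\<close>

context
  fixes \<pi> :: "int list pmf"
  assumes \<pi>: "stationary_distribution L p q \<pi>"
begin

abbreviation E :: "(int list \<Rightarrow> real) \<Rightarrow> real" where "E \<equiv> measure_pmf.expectation \<pi>"

lemma set_pmf_stationary: "set_pmf \<pi> \<subseteq> S"
  and bind_pmf_stationary: "bind_pmf \<pi> (incr_kernel p q) = \<pi>"
  using \<pi> by (auto simp: stationary_distribution_def)

lemma integrable_stationary [simp]: "integrable (measure_pmf \<pi>) (\<phi> :: int list \<Rightarrow> real)"
  by (intro integrable_measure_pmf_finite finite_subset[OF set_pmf_stationary]) simp

lemma expectation_stationary_sum: "E \<phi> = (\<Sum>\<eta>\<in>S. \<phi> \<eta> * pmf \<pi> \<eta>)"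
  using set_pmf_stationary by (intro integral_measure_pmf_real) auto

lemma expectation_stationary_cong:
  "(\<And>\<eta>. \<eta> \<in> S \<Longrightarrow> \<phi> \<eta> = \<psi> \<eta>) \<Longrightarrow> E \<phi> = E \<psi>"
  unfolding expectation_stationary_sum by (simp cong: sum.cong)

lemma expectation_incr_op: "E (P \<phi>) = E \<phi>"
proof -
  have "E \<phi> = measure_pmf.expectation (bind_pmf \<pi> (incr_kernel p q)) \<phi>"
    by (simp add: bind_pmf_stationary)
  also have "\<dots> = (\<Sum>\<eta>\<in>S. pmf \<pi> \<eta> *\<^sub>R P \<phi> \<eta>)"
    using set_pmf_stationary by (subst pmf_expectation_bind) (auto simp: expectation_incr_kernel)
  finally show ?thesis by (simp add: expectation_stationary_sum mult.commute)
qed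

lemma expectation_funpow_incr_op: "E ((P ^^ k) \<phi>) = E \<phi>"
  by (induction k) (simp_all add: expectation_incr_op)

text \<open>An interval containing all values on \<open>S\<close> also contains their mean 0, so no
  value is further from 0 than the length of the interval.\<close>

lemma osc_within_abs_le:
  assumes "osc_within \<phi> d" "E \<phi> = 0" "\<eta> \<in> S"
  shows "\<bar>\<phi> \<eta>\<bar> \<le> d"
proof -
  obtain a where a: "\<And>\<eta>. \<eta> \<in> S \<Longrightarrow> a \<le> \<phi> \<eta> \<and> \<phi> \<eta> \<le> a + d"
    using assms unfolding osc_within_def by blast
  have "a \<le> E \<phi>" "E \<phi> \<le> a + d"
    using a set_pmf_stationary
    by (intro measure_pmf.integral_ge_const measure_pmf.integral_le_const; force simp: AE_measure_pmf_iff)+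
  with a[OF assms(3)] assms(2) show ?thesis by linarith
qed

lemma summable_funpow_incr_op:
  assumes "E \<phi> = 0" "\<eta> \<in> S"
  shows "summable (\<lambda>k. (P ^^ k) \<phi> \<eta>)"
proof -
  obtain d where d: "osc_within \<phi> d" using osc_within_exists by blast
  have "0 < \<delta> ^ L" "\<delta> ^ L < 1"
    using step_bound_pos step_bound_less_1 L by (auto intro!: power_Suc_less_one simp: power_less_one_iff)
  then have "summable (\<lambda>k. (1 - \<delta> ^ L) ^ (k div L) * d)"
    by (intro summable_mult2 summable_power_div L) auto
  then show ?thesis
  proof (rule summable_comparison_test')
    fix k :: nat
    show "norm ((P ^^ k) \<phi> \<eta>) \<le> (1 - \<delta> ^ L) ^ (k div L) * d"
      using osc_within_abs_le[OF osc_within_geometric[OF d] _ assms(2)] assms(1)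
      by (simp add: expectation_funpow_incr_op)
  qed
qed

text \<open>The solution is the Neumann series: applying the operator shifts it by one term and
  loses \<open>\<phi>\<close>. It converges because mean zero turns contracting oscillation into
  geometric decay. Setting \<open>g\<close> to 0 off \<open>S\<close> makes it bounded on all
  lists.\<close>

lemma poisson_equation:
  assumes "E \<phi> = 0"
  obtains g where "\<And>\<eta>. \<eta> \<in> S \<Longrightarrow> (\<lambda>k. (P ^^ k) \<phi> \<eta>) sums g \<eta>"
    and "\<And>\<eta>. \<eta> \<in> S \<Longrightarrow> P g \<eta> = g \<eta> - \<phi> \<eta>"
    and "\<And>\<eta>. \<eta> \<notin> S \<Longrightarrow> g \<eta> = 0"
proof
  define g where "g \<eta> = (if \<eta> \<in> S then \<Sum>k. (P ^^ k) \<phi> \<eta> else 0)" for \<eta>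
  show sums: "(\<lambda>k. (P ^^ k) \<phi> \<eta>) sums g \<eta>" if "\<eta> \<in> S" for \<eta>
    using summable_funpow_incr_op[OF assms that] that by (simp add: g_def summable_sums)
  show "g \<eta> = 0" if "\<eta> \<notin> S" for \<eta>
    using that by (simp add: g_def)
  show "P g \<eta> = g \<eta> - \<phi> \<eta>" if "\<eta> \<in> S" for \<eta>
  proof -
    have "(\<lambda>k. (P ^^ Suc k) \<phi> \<eta>) sums P g \<eta>"
      unfolding funpow.simps comp_def incr_op_def[of _ _ g] incr_op_def[of _ _ "(P ^^ _) \<phi>"]
      using that L
      by (intro sums_add sums_mult sums Cons_butlast_in_incr_states) auto
    moreover have "(\<lambda>k. (P ^^ Suc k) \<phi> \<eta>) sums (g \<eta> - \<phi> \<eta>)"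
      using sums_Suc_iff[of "\<lambda>k. (P ^^ k) \<phi> \<eta>" "g \<eta> - \<phi> \<eta>"] sums[OF that] by simp
    ultimately show ?thesis by (rule sums_unique2)
  qed
qed

text \<open>By invariance \<open>first_coord\<close> may be replaced by its one-step average
  \<open>2 * incr_up_prob p q \<eta> - 1\<close>, which is \<open>2 * p - 1\<close> on local maxima,
  \<open>2 * q - 1\<close> on local minima and 0 elsewhere.\<close>

lemma expectation_first_coord: "E first_coord = drift p q \<pi>"
proof -
  have eq: "P first_coord \<eta> = (2 * p - 1) * indicator {\<eta>. local_max \<eta>} \<eta>
      + (2 * q - 1) * indicator {\<eta>. local_min \<eta>} \<eta>" if "\<eta> \<in> S" for \<eta>
  proof -
    \<comment> \<open>The first partial sum is 1 or -1, so the two classes are disjoint.\<close>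
    have "\<not> (local_max \<eta> \<and> local_min \<eta>)"
    proof
      assume *: "local_max \<eta> \<and> local_min \<eta>"
      with that L have "partial_sum \<eta> 1 = 0"
        by (intro antisym) (auto simp: local_max_def local_min_def incr_states_def)
      with that L show False
        by (cases \<eta>) (auto simp: partial_sum_def incr_states_def)
    qed
    then show ?thesis
      by (auto simp: incr_op_def first_coord_def incr_up_prob_def)
  qed
  have "E first_coord = E (P first_coord)" by (simp add: expectation_incr_op)
  also have "\<dots> = E (\<lambda>\<eta>. (2 * p - 1) * indicator {\<eta>. local_max \<eta>} \<eta>
      + (2 * q - 1) * indicator {\<eta>. local_min \<eta>} \<eta>)"
    by (rule expectation_stationary_cong) (rule eq)
  also have "\<dots> = drift p q \<pi>" by (simp add: drift_def)
  finally show ?thesis .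
qed

text \<open>In a history the initial state is \<open>last l\<close> and the current one
  \<open>hd l\<close>. Averaging over the newest state replaces \<open>b\<close> by
  \<open>P b\<close>, so the induction runs over all \<open>b\<close>.\<close>

lemma expectation_history_pmf:
  "measure_pmf.expectation (history_pmf \<pi> (\<lambda>l. incr_kernel p q (hd l)) k) (\<lambda>l. a (last l) * b (hd l))
    = E (\<lambda>\<eta>. a \<eta> * (P ^^ k) b \<eta>)"
proof (induction k arbitrary: b)
  case 0
  show ?case by simp
next
  case (Suc k)
  let ?H = "history_pmf \<pi> (\<lambda>l. incr_kernel p q (hd l)) k"
  have fin: "finite (set_pmf ?H)"
    using set_pmf_stationary by (intro finite_set_history_pmf) (auto intro: finite_subset)
  have "measure_pmf.expectation (history_pmf \<pi> (\<lambda>l. incr_kernel p q (hd l)) (Suc k)) (\<lambda>l. a (last l) * b (hd l))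
      = (\<Sum>l\<in>set_pmf ?H. pmf ?H l *\<^sub>R measure_pmf.expectation
          (map_pmf (\<lambda>z. z # l) (incr_kernel p q (hd l))) (\<lambda>l. a (last l) * b (hd l)))"
    unfolding history_pmf.simps by (rule pmf_expectation_bind) (auto simp: fin)
  also have "\<dots> = (\<Sum>l\<in>set_pmf ?H. a (last l) * P b (hd l) * pmf ?H l)"
  proof (rule sum.cong)
    fix l assume "l \<in> set_pmf ?H"
    then have "l \<noteq> []" using length_set_history_pmf by fastforce
    then show "pmf ?H l *\<^sub>R measure_pmf.expectation
        (map_pmf (\<lambda>z. z # l) (incr_kernel p q (hd l))) (\<lambda>l. a (last l) * b (hd l))
        = a (last l) * P b (hd l) * pmf ?H l"
      by (simp add: expectation_incr_kernel)
  qed simp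
  also have "\<dots> = measure_pmf.expectation ?H (\<lambda>l. a (last l) * P b (hd l))"
    by (rule integral_measure_pmf_real[symmetric]) (auto simp: fin)
  also have "\<dots> = E (\<lambda>\<eta>. a \<eta> * (P ^^ Suc k) b \<eta>)"
    by (simp add: Suc.IH funpow_swap1)
  finally show ?case .
qed

lemma covariance_increment_chain:
  assumes "increment_chain N p q \<pi> Y"
  defines "f \<equiv> (\<lambda>\<eta>. first_coord \<eta> - drift p q \<pi>)"
  shows "covariance_of N (\<lambda>\<omega>. first_coord (Y 1 \<omega>)) (\<lambda>\<omega>. first_coord (Y (k + 1) \<omega>))
      = E (\<lambda>\<eta>. f \<eta> * (P ^^ k) f \<eta>)"
proof -
  interpret N: increment_chain N p q \<pi> Y by fact
  \<comment> \<open>\<open>Y\<close> starts at time 1 and histories at time 0, hence the shift;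
    \<open>Y 1\<close> and \<open>Y (k + 1)\<close> become the two ends of the history up to
    \<open>k\<close>.\<close>
  define Z where "Z k = Y (Suc k)" for k
  have Z [measurable]: "Z k \<in> measurable N (count_space UNIV)" for k
    unfolding Z_def by (rule N.Y_measurable) simp
  have distr: "distr N (count_space UNIV) (history Z k)
      = measure_pmf (history_pmf \<pi> (\<lambda>l. incr_kernel p q (hd l)) k)" for k
  proof (rule N.distr_history)
    show "N.prob {\<omega> \<in> space N. Z 0 \<omega> = z} = pmf \<pi> z" for z
      using N.initial[of z] by (simp add: Z_def)
    fix k and l :: "int list list" and z
    assume l: "length l = Suc k" and pos: "N.prob {\<omega> \<in> space N. history Z k \<omega> = l} > 0"
    \<comment> \<open>Time \<open>i\<close> sits at position \<open>Suc k - i\<close>, since the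
      most recent state comes first.\<close>
    define y where "y i = l ! (Suc k - i)" for i
    have "history Z k \<omega> = l \<longleftrightarrow> (\<forall>i\<in>{1..Suc k}. Y i \<omega> = y i)" for \<omega>
    proof -
      have "history Z k \<omega> = l \<longleftrightarrow> (\<forall>i\<in>{..k}. Y (Suc i) \<omega> = y (Suc i))"
        by (auto simp: history_eq_iff[OF l] Z_def y_def)
      also have "\<dots> \<longleftrightarrow> (\<forall>i\<in>Suc ` {..k}. Y i \<omega> = y i)" by blast
      also have "Suc ` {..k} = {1..Suc k}" by (simp add: image_Suc_atMost)
      finally show ?thesis .
    qed
    with N.transition[of "Suc k" y z] pos l
    have "N.prob {\<omega> \<in> space N. Z (Suc k) \<omega> = z \<and> history Z k \<omega> = l}
        / N.prob {\<omega> \<in> space N. history Z k \<omega> = l} = pmf (incr_kernel p q (y (Suc k))) z"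
      by (simp add: cond_prob_def Z_def)
    moreover have "y (Suc k) = hd l" using l by (simp add: y_def hd_conv_nth flip: length_greater_0_conv)
    ultimately show "N.prob {\<omega> \<in> space N. Z (Suc k) \<omega> = z \<and> history Z k \<omega> = l}
        = pmf (incr_kernel p q (hd l)) z * N.prob {\<omega> \<in> space N. history Z k \<omega> = l}"
      using pos by (simp add: field_simps)
  qed (rule Z)
  have ends: "hd (history Z k \<omega>) = Y (k + 1) \<omega>" "last (history Z k \<omega>) = Y 1 \<omega>" for k \<omega>
  proof -
    show "hd (history Z k \<omega>) = Y (k + 1) \<omega>" by (cases k) (auto simp: Z_def)
    show "last (history Z k \<omega>) = Y 1 \<omega>"
    proof (induction k)
      case (Suc k)
      then show ?case using length_history[of Z k \<omega>] by (auto simp del: length_history)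
    qed (simp add: Z_def)
  qed
  have *: "(LINT \<omega>|N. a (Y 1 \<omega>) * b (Y (k + 1) \<omega>)) = E (\<lambda>\<eta>. a \<eta> * (P ^^ k) b \<eta>)"
    for a b :: "int list \<Rightarrow> real" and k
  proof -
    have "(LINT \<omega>|N. a (Y 1 \<omega>) * b (Y (k + 1) \<omega>))
        = (LINT l|distr N (count_space UNIV) (history Z k). a (last l) * b (hd l))"
      by (subst integral_distr[OF measurable_history[OF Z]]) (auto simp: ends)
    then show ?thesis by (simp only: distr expectation_history_pmf)
  qed
  \<comment> \<open>With first factor 1 the identity gives the mean, which by invariance does not
    depend on \<open>k\<close>.\<close>
  have mean: "(LINT \<omega>|N. first_coord (Y (k + 1) \<omega>)) = drift p q \<pi>" for k
    using *[of "\<lambda>_. 1" first_coord k]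
    by (simp add: expectation_funpow_incr_op expectation_first_coord)
  show ?thesis
    using *[of f f k] mean[of 0] mean[of k] unfolding covariance_of_def f_def by simp
qed

end
end

section \<open>The walk as a function of its history\<close>

text \<open>\<open>up_prob\<close> expects a path in time order, hence the reversed indexing of
  \<open>l\<close>, whose head is the current position.\<close>

definition walk_kernel :: "nat \<Rightarrow> real \<Rightarrow> real \<Rightarrow> int list \<Rightarrow> int pmf" where
  "walk_kernel L p q l =
     map_pmf (\<lambda>up. if up then hd l + 1 else hd l - 1)
       (bernoulli_pmf (up_prob L p q (\<lambda>i. l ! (length l - 1 - i)) (length l - 1)))"

text \<open>Positions run backwards in time, so the newest increment comes first. For a
  nearest-neighbour path with more than \<open>L\<close> positions, \<open>take L\<close> of the
  result is a state of the increment chain.\<close>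

definition increments :: "int list \<Rightarrow> int list" where
  "increments l = map2 (-) l (tl l)"

definition nn_path :: "int list \<Rightarrow> bool" where
  "nn_path l \<longleftrightarrow> set (increments l) \<subseteq> {-1, 1}"

lemma length_increments [simp]: "length (increments l) = length l - 1"
  by (simp add: increments_def)

lemma increments_Cons: "l \<noteq> [] \<Longrightarrow> increments (z # l) = (z - hd l) # increments l"
  by (cases l) (auto simp: increments_def)

text \<open>The sum telescopes to the current position minus the one \<open>j\<close> steps earlier;
  this translates extrema of positions into signs of partial sums.\<close>

lemma partial_sum_increments:
  assumes "j < length l"
  shows "partial_sum (increments l) j = l ! 0 - l ! j"
  using assms
proof (induction l arbitrary: j)
  case (Cons z l)
  show ?case
  proof (cases j)
    case (Suc i)
    with Cons.prems have "l \<noteq> []" by auto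
    with Cons Suc show ?thesis
      by (simp add: increments_Cons partial_sum_def hd_conv_nth)
  qed (simp add: partial_sum_def)
qed simp

lemma partial_sum_take: "j \<le> L \<Longrightarrow> partial_sum (take L \<eta>) j = partial_sum \<eta> j"
  by (simp add: partial_sum_def min_def)

lemma take_increments_Cons:
  assumes "L \<ge> 1" "L < length l"
  shows "take L (increments (z # l)) = (z - hd l) # butlast (take L (increments l))"
proof -
  have "l \<noteq> []" using assms by auto
  with assms show ?thesis by (simp add: increments_Cons take_Cons' butlast_take)
qed

text \<open>The current position is the maximum of its window iff the partial sums up to
  \<open>L\<close> are all nonnegative, and dually for the minimum. As \<open>L < length l\<close>,
  the window is not cut off at time 0; a tie of maximum and minimum is impossible because the newest
  increment is nonzero.\<close>

lemma up_prob_eq_incr_up_prob: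
  assumes L: "L \<ge> 1" "L < length l" and nn: "nn_path l"
  shows "up_prob L p q (\<lambda>i. l ! (length l - 1 - i)) (length l - 1)
    = incr_up_prob p q (take L (increments l))"
proof -
  let ?k = "length l - 1" and ?\<eta> = "take L (increments l)"
  define W where "W = (\<lambda>m. l ! m) ` {0..L}"
  have W: "(\<lambda>m. l ! (?k - (?k - m))) ` {0..min L ?k} = W"
    unfolding W_def using L by (intro image_cong) auto
  have ps: "partial_sum ?\<eta> j = l ! 0 - l ! j" if "j \<le> L" for j
    using that L by (simp add: partial_sum_take partial_sum_increments)
  have len: "length ?\<eta> = L" using L by simp
  have fin: "finite W" "W \<noteq> {}" "l ! 0 \<in> W" by (auto simp: W_def)
  have max: "l ! 0 = Max W \<longleftrightarrow> local_max ?\<eta>"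
  proof -
    have "l ! 0 = Max W \<longleftrightarrow> (\<forall>x\<in>W. x \<le> l ! 0)"
      using fin by (metis Max_eqI Max_ge)
    also have "\<dots> \<longleftrightarrow> local_max ?\<eta>"
      unfolding W_def local_max_def len using ps by (auto simp: Suc_le_eq)
    finally show ?thesis .
  qed
  have min: "l ! 0 = Min W \<longleftrightarrow> local_min ?\<eta>"
  proof -
    have "l ! 0 = Min W \<longleftrightarrow> (\<forall>x\<in>W. l ! 0 \<le> x)"
      using fin by (metis Min_eqI Min_le)
    also have "\<dots> \<longleftrightarrow> local_min ?\<eta>"
      unfolding W_def local_min_def len using ps by (auto simp: Suc_le_eq)
    finally show ?thesis .
  qed
  have "\<not> (local_max ?\<eta> \<and> local_min ?\<eta>)"
  proof
    assume "local_max ?\<eta> \<and> local_min ?\<eta>"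
    then have "partial_sum ?\<eta> 1 = 0"
      unfolding local_max_def local_min_def len using L by (intro antisym) auto
    moreover have "partial_sum ?\<eta> 1 = increments l ! 0"
      using L by (simp add: partial_sum_take) (simp add: partial_sum_def take_Suc_conv_app_nth)
    moreover have "increments l ! 0 \<in> set (increments l)" using L by (intro nth_mem) simp
    ultimately show False using nn by (auto simp: nn_path_def)
  qed
  then show ?thesis
    unfolding up_prob_def Let_def W incr_up_prob_def using max min by auto
qed

lemma set_history_walk_kernel:
  "l \<in> set_pmf (history_pmf \<mu> (walk_kernel L p q) k) \<Longrightarrow> nn_path l"
proof (induction k arbitrary: l)
  case 0
  then show ?case by (auto simp: nn_path_def increments_def)
next
  case (Suc k)
  then obtain l' z where l': "l' \<in> set_pmf (history_pmf \<mu> (walk_kernel L p q) k)"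
    and z: "z \<in> set_pmf (walk_kernel L p q l')" and l: "l = z # l'"
    by auto
  have "l' \<noteq> []" using length_set_history_pmf[OF l'] by auto
  moreover have "z - hd l' \<in> {-1, 1}"
    using z by (auto simp: walk_kernel_def)
  ultimately show ?case
    using Suc.IH[OF l'] by (auto simp: l nn_path_def increments_Cons)
qed

lemma up_prob_bounds:
  "0 \<le> p \<Longrightarrow> p \<le> 1 \<Longrightarrow> 0 \<le> q \<Longrightarrow> q \<le> 1 \<Longrightarrow> 0 \<le> up_prob L p q x k"
  "0 \<le> p \<Longrightarrow> p \<le> 1 \<Longrightarrow> 0 \<le> q \<Longrightarrow> q \<le> 1 \<Longrightarrow> up_prob L p q x k \<le> 1"
  by (auto simp: up_prob_def Let_def)

lemma expectation_bernoulli_complex: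
  fixes f :: "bool \<Rightarrow> complex"
  assumes "0 \<le> u" "u \<le> 1"
  shows "measure_pmf.expectation (bernoulli_pmf u) f = of_real u * f True + of_real (1 - u) * f False"
  using assms by (subst integral_measure_pmf[where A = UNIV]) (simp_all add: UNIV_bool scaleR_conv_of_real)

lemma (in perturbed_walk) distr_walk_history:
  assumes pq: "0 \<le> p" "p \<le> 1" "0 \<le> q" "q \<le> 1"
    and \<mu>: "\<And>z. prob {\<omega> \<in> space M. X 0 \<omega> = z} = pmf \<mu> z"
  shows "distr M (count_space UNIV) (history X k) = measure_pmf (history_pmf \<mu> (walk_kernel L p q) k)"
proof (rule distr_history)
  show "X k \<in> measurable M (count_space UNIV)" for k by (rule X_measurable)
  show "prob {\<omega> \<in> space M. X 0 \<omega> = z} = pmf \<mu> z" for z by (rule \<mu>)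
next
  note [measurable] = X_measurable measurable_history[OF X_measurable]
  fix k and l :: "int list" and z
  assume l: "length l = Suc k" and pos: "prob {\<omega> \<in> space M. history X k \<omega> = l} > 0"
  define x where "x i = l ! (k - i)" for i
  define u where "u = up_prob L p q x k"
  have u: "0 \<le> u" "u \<le> 1" unfolding u_def using pq by (auto intro: up_prob_bounds)
  have hx: "history X k \<omega> = l \<longleftrightarrow> (\<forall>i\<le>k. X i \<omega> = x i)" for \<omega>
    by (simp add: history_eq_iff[OF l] x_def)
  have hd: "x k = hd l" using l by (simp add: x_def hd_conv_nth flip: length_greater_0_conv)
  let ?Q = "prob {\<omega> \<in> space M. history X k \<omega> = l}"
  let ?R = "\<lambda>z. prob {\<omega> \<in> space M. X (Suc k) \<omega> = z \<and> history X k \<omega> = l}"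
  have up: "?R (hd l + 1) = u * ?Q"
    using step_up[of k x] pos by (simp add: cond_prob_def hd u_def field_simps flip: hx)
  have down: "?R (hd l - 1) = (1 - u) * ?Q"
    using step_down[of k x] pos by (simp add: cond_prob_def hd u_def field_simps flip: hx)
  have K: "walk_kernel L p q l = map_pmf (\<lambda>up. if up then hd l + 1 else hd l - 1) (bernoulli_pmf u)"
    unfolding walk_kernel_def u_def x_def using l by simp
  have inj: "inj (\<lambda>up. if up then hd l + 1 else hd l - 1)" by (auto simp: inj_def)
  show "?R z = pmf (walk_kernel L p q l) z * ?Q"
  proof -
    consider "z = hd l + 1" | "z = hd l - 1" | "z \<noteq> hd l + 1" "z \<noteq> hd l - 1" by blast
    then show ?thesis
    proof cases
      case 1
      have "pmf (walk_kernel L p q l) z = u"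
        using pmf_map_inj'[OF inj, of "bernoulli_pmf u" True] u by (simp add: K 1)
      then show ?thesis using up 1 by simp
    next
      case 2
      have "pmf (walk_kernel L p q l) z = 1 - u"
        using pmf_map_inj'[OF inj, of "bernoulli_pmf u" False] u by (simp add: K 2)
      then show ?thesis using down 2 by simp
    next
      case 3
      have "z \<notin> set_pmf (walk_kernel L p q l)" using 3 by (auto simp: K)
      then have 0: "pmf (walk_kernel L p q l) z = 0" by (simp add: pmf_eq_0_set_pmf)
      let ?A = "\<lambda>z. {\<omega> \<in> space M. X (Suc k) \<omega> = z \<and> history X k \<omega> = l}"
      \<comment> \<open>The two neighbours already exhaust the probability of the history, so
        nothing is left for \<open>z\<close>.\<close>
      have "?R (hd l + 1) + ?R (hd l - 1) + ?R z = prob ((?A (hd l + 1) \<union> ?A (hd l - 1)) \<union> ?A z)"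
        using 3 by (subst finite_measure_Union, measurable, force, subst finite_measure_Union, measurable, force, simp)
      also have "\<dots> \<le> ?Q" by (intro finite_measure_mono) auto
      finally have "?R z \<le> 0" using up down by (simp only: algebra_simps)
      then have "?R z = 0" by (simp add: measure_le_0_iff)
      with 0 show ?thesis by simp
    qed
  qed
qed

section \<open>Characteristic functions\<close>

lemma cis_taylor2: "norm (cis y - (1 + \<i> * y - y\<^sup>2 / 2)) \<le> \<bar>y\<bar> ^ 3"
proof -
  have "{..2::nat} = {0, 1, 2}" by auto
  then have "(\<Sum>k\<le>2. (\<i> * y) ^ k / fact k) = 1 + \<i> * y - y\<^sup>2 / 2"
    by (simp add: power_mult_distrib)
  moreover have "iexp y = cis y" by (simp add: cis_conv_exp)
  ultimately have "norm (cis y - (1 + \<i> * y - y\<^sup>2 / 2)) \<le> \<bar>y\<bar> ^ 3 / fact 3"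
    using iexp_approx1[of y 2] by (simp add: numeral_3_eq_3 numeral_2_eq_2)
  also have "\<dots> \<le> \<bar>y\<bar> ^ 3" by (simp add: fact_numeral)
  finally show ?thesis .
qed

text \<open>Multiply the second-order expansion of \<open>cis (s * c)\<close> into the quadratic.
  The Taylor remainder and the products of order 3 and 4 form the error, where
  \<open>\<bar>s\<bar> \<le> 1\<close> reduces order 4 to order 3.\<close>

lemma cis_mult_quadratic_approx:
  fixes s c g h B C :: real
  assumes "\<bar>s\<bar> \<le> 1" "\<bar>c\<bar> \<le> C" "\<bar>g\<bar> \<le> B" "\<bar>h\<bar> \<le> B"
  shows "norm (cis (s * c) * (1 + \<i> * s * g + s\<^sup>2 * h)
      - (1 + \<i> * s * (c + g) + s\<^sup>2 * (h - c\<^sup>2 / 2 - c * g)))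
    \<le> (C ^ 3 * (1 + 2 * B) + C * B + C\<^sup>2 * B) * \<bar>s\<bar> ^ 3"
proof -
  define R where "R = cis (s * c) - (1 + \<i> * (s * c) - (s * c)\<^sup>2 / 2)"
  define w :: complex where "w = 1 + \<i> * s * g + s\<^sup>2 * h"
  have pos: "0 \<le> B" "0 \<le> C" using assms by linarith+
  have eq: "cis (s * c) * w - (1 + \<i> * s * (c + g) + s\<^sup>2 * (h - c\<^sup>2 / 2 - c * g))
      = R * w + (\<i> * (s ^ 3 * (c * h)) - \<i> * (s ^ 3 * (c\<^sup>2 * g / 2)) - s ^ 3 * (s * (c\<^sup>2 * h / 2)))"
    by (simp add: R_def w_def algebra_simps power2_eq_square power3_eq_cube)
  have s2: "s\<^sup>2 \<le> 1" using assms(1) by (simp add: abs_square_le_1)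
  have "norm w \<le> 1 + \<bar>s\<bar> * \<bar>g\<bar> + s\<^sup>2 * \<bar>h\<bar>"
    unfolding w_def by (rule order.trans[OF norm_triangle_ineq] add_mono norm_triangle_ineq)+
      (simp_all add: norm_mult norm_power)
  also have "\<dots> \<le> 1 + 1 * B + 1 * B"
    using assms s2 pos by (intro add_mono mult_mono) auto
  finally have w: "norm w \<le> 1 + 2 * B" by simp
  have "norm R \<le> \<bar>s * c\<bar> ^ 3" unfolding R_def using cis_taylor2[of "s * c"] by simp
  also have "\<dots> \<le> \<bar>s\<bar> ^ 3 * C ^ 3"
    using assms by (auto simp: abs_mult power_mult_distrib intro!: mult_left_mono power_mono)
  finally have "norm R * norm w \<le> (\<bar>s\<bar> ^ 3 * C ^ 3) * (1 + 2 * B)"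
    using w pos by (intro mult_mono) auto
  moreover have "norm (\<i> * (s ^ 3 * (c * h)) - \<i> * (s ^ 3 * (c\<^sup>2 * g / 2)) - s ^ 3 * (s * (c\<^sup>2 * h / 2)) :: complex)
      \<le> \<bar>s\<bar> ^ 3 * (\<bar>c\<bar> * \<bar>h\<bar>) + \<bar>s\<bar> ^ 3 * (c\<^sup>2 * \<bar>g\<bar> / 2) + \<bar>s\<bar> ^ 3 * (\<bar>s\<bar> * (c\<^sup>2 * \<bar>h\<bar> / 2))"
    by (rule order.trans[OF norm_triangle_ineq4] add_mono norm_triangle_ineq4)+
      (simp_all add: norm_mult norm_power norm_divide)
  moreover have "\<dots> \<le> \<bar>s\<bar> ^ 3 * (C * B) + \<bar>s\<bar> ^ 3 * (C\<^sup>2 * B / 2) + \<bar>s\<bar> ^ 3 * (1 * (C\<^sup>2 * B / 2))"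
    using assms pos power_mono[of "\<bar>c\<bar>" C 2]
    by (intro add_mono mult_mono divide_right_mono) auto
  ultimately have "norm (R * w + (\<i> * (s ^ 3 * (c * h)) - \<i> * (s ^ 3 * (c\<^sup>2 * g / 2)) - s ^ 3 * (s * (c\<^sup>2 * h / 2))))
      \<le> \<bar>s\<bar> ^ 3 * C ^ 3 * (1 + 2 * B)
        + (\<bar>s\<bar> ^ 3 * (C * B) + \<bar>s\<bar> ^ 3 * (C\<^sup>2 * B / 2) + \<bar>s\<bar> ^ 3 * (1 * (C\<^sup>2 * B / 2)))"
    by (intro order.trans[OF norm_triangle_ineq] add_mono) (auto simp: norm_mult)
  then show ?thesis
    unfolding eq[unfolded w_def] w_def by (simp add: algebra_simps)
qed

text \<open>Each of the \<open>m\<close> errors is amplified by at most \<open>r ^ m\<close>, as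
  \<open>r\<close> is at least 1. The start at \<open>L\<close> reflects that the walk obeys its
  recursion only once a full window of increments is available.\<close>

lemma approximate_geometric_bound:
  fixes a :: "nat \<Rightarrow> complex" and z :: complex and r \<epsilon> :: real
  assumes step: "\<And>n. n \<ge> L \<Longrightarrow> norm (a (Suc n) - z * a n) \<le> \<epsilon>"
    and "norm z \<le> r" "1 \<le> r" "0 \<le> \<epsilon>"
  shows "norm (a (L + m) - z ^ m * a L) \<le> m * \<epsilon> * r ^ m"
proof (induction m)
  case (Suc m)
  have "norm (a (L + Suc m) - z ^ Suc m * a L)
      = norm ((a (Suc (L + m)) - z * a (L + m)) + z * (a (L + m) - z ^ m * a L))"
    by (simp add: algebra_simps)
  also have "\<dots> \<le> \<epsilon> + r * (m * \<epsilon> * r ^ m)"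
    using assms Suc.IH
    by (intro order.trans[OF norm_triangle_ineq] add_mono step) (auto simp: norm_mult intro!: mult_mono)
  also have "\<dots> \<le> \<epsilon> * r ^ Suc m + r * (m * \<epsilon> * r ^ m)"
    using mult_left_mono[of 1 "r ^ Suc m" \<epsilon>] assms one_le_power[of r "Suc m"] by simp
  also have "\<epsilon> * r ^ Suc m + r * (m * \<epsilon> * r ^ m) = Suc m * \<epsilon> * r ^ Suc m"
    by (simp add: algebra_simps)
  finally show ?case by simp
qed simp

text \<open>Dropping \<open>L\<close> factors does not change the limit, since each of them tends to
  1.\<close>

lemma tendsto_one_plus_div_power:
  fixes x :: real
  shows "(\<lambda>n. (1 + x / real n) ^ (n - L)) \<longlonglongrightarrow> exp x"
proof -
  have "(\<lambda>n. 1 + x / real n) \<longlonglongrightarrow> 1 + 0"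
    by (intro tendsto_add tendsto_const lim_const_over_n)
  then have 1: "(\<lambda>n. 1 + x / real n) \<longlonglongrightarrow> 1" by simp
  from tendsto_divide[OF tendsto_exp_limit_sequentially[of x] tendsto_power[OF 1, of L]]
  have "(\<lambda>n. (1 + x / real n) ^ n / (1 + x / real n) ^ L) \<longlonglongrightarrow> exp x" by simp
  moreover have "\<forall>\<^sub>F n in sequentially. (1 + x / real n) ^ n / (1 + x / real n) ^ L = (1 + x / real n) ^ (n - L)"
    using eventually_ge_at_top[of L] order_tendstoD(1)[OF 1 zero_less_one]
    by eventually_elim (simp add: power_diff)
  ultimately show ?thesis by (rule Lim_transform_eventually)
qed

text \<open>For \<open>v > 0\<close> the law is the image of the standard normal law under
  multiplication by \<open>sqrt v\<close>; for \<open>v = 0\<close> it is the point mass at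
  0.\<close>

lemma char_centered_normal:
  assumes "v \<ge> 0"
  shows "real_distribution (centered_normal v)"
    and "char (centered_normal v) t = of_real (exp (- v * t\<^sup>2 / 2))"
proof -
  have "real_distribution (centered_normal v) \<and> char (centered_normal v) t = of_real (exp (- v * t\<^sup>2 / 2))"
  proof (cases "v = 0")
    case True
    then show ?thesis
      by (auto simp: centered_normal_def char_def real_distribution_def real_distribution_axioms_def
          prob_space_return integral_return)
  next
    case False
    define \<sigma> where "\<sigma> = sqrt v"
    have \<sigma>: "\<sigma> > 0" "\<sigma>\<^sup>2 = v" using assms False by (auto simp: \<sigma>_def)
    interpret std: real_distribution std_normal_distribution by (rule real_dist_normal_dist)
    have "distributed std_normal_distribution lborel (\<lambda>x. x) (normal_density 0 1)"
      by (auto simp: distributed_def distr_id2)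
    from std.normal_density_affine[OF this, of \<sigma> 0] \<sigma>
    have "distributed std_normal_distribution lborel (\<lambda>x. \<sigma> * x) (normal_density 0 \<sigma>)" by simp
    then have eq: "centered_normal v = distr std_normal_distribution lborel (\<lambda>x. \<sigma> * x)"
      using False by (simp add: centered_normal_def \<sigma>_def distributed_def)
    have "prob_space (centered_normal v)" unfolding eq by (rule std.prob_space_distr) simp
    moreover have "char (centered_normal v) t = char std_normal_distribution (t * \<sigma>)"
      unfolding char_def eq by (subst integral_distr) (auto simp: mult.assoc)
    ultimately show ?thesis
      using \<sigma> False by (auto simp: char_std_normal_distribution power_mult_distrib real_distribution_def
          real_distribution_axioms_def centered_normal_def mult.commute)
  qed
  then show "real_distribution (centered_normal v)"
    and "char (centered_normal v) t = of_real (exp (- v * t\<^sup>2 / 2))" by auto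
qed

section \<open>The tilted transition operator and its approximate eigenvector\<close>

context incr_params
begin

text \<open>The Fourier perturbation of \<open>P\<close>: a step is weighted by \<open>cis\<close>
  of \<open>s\<close> times its increment, as yet without centring.\<close>

definition tilted_op :: "real \<Rightarrow> (int list \<Rightarrow> complex) \<Rightarrow> int list \<Rightarrow> complex" where
  "tilted_op s w \<eta> = of_real (incr_up_prob p q \<eta>) * cis s * w (1 # butlast \<eta>)
                   + of_real (1 - incr_up_prob p q \<eta>) * cis (- s) * w (- 1 # butlast \<eta>)"

lemma take_increments_in_states:
  assumes "l \<in> set_pmf (history_pmf \<mu> (walk_kernel L p q) n)" "n \<ge> L"
  shows "take L (increments l) \<in> S"
  using set_history_walk_kernel[OF assms(1)] length_set_history_pmf[OF assms(1)] assms(2)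
  by (auto simp: nn_path_def incr_states_def dest: in_set_takeD)

text \<open>The newest increment multiplies the phase by \<open>cis s\<close> or
  \<open>cis (- s)\<close> and shifts the window of increments; integrating it out leaves
  \<open>tilted_op\<close>. From time \<open>L\<close> on the window is full, so its up-probability
  is that of the increment chain.\<close>

lemma expectation_walk_step:
  fixes w :: "int list \<Rightarrow> complex" and \<mu> :: "int pmf" and s :: real
  assumes B: "\<And>\<eta>. norm (w \<eta>) \<le> B" and n: "n \<ge> L"
  defines "H \<equiv> history_pmf \<mu> (walk_kernel L p q)"
  shows "measure_pmf.expectation (H (Suc n)) (\<lambda>l. cis (s * real_of_int (hd l)) * w (take L (increments l)))
    = measure_pmf.expectation (H n) (\<lambda>l. cis (s * real_of_int (hd l)) * tilted_op s w (take L (increments l)))"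
proof -
  let ?h = "\<lambda>l. cis (s * real_of_int (hd l)) * w (take L (increments l))"
  have "measure_pmf.expectation (H (Suc n)) ?h
      = measure_pmf.expectation (H n) (\<lambda>l. measure_pmf.expectation (map_pmf (\<lambda>z. z # l) (walk_kernel L p q l)) ?h)"
    unfolding H_def history_pmf.simps
    by (rule integral_bind_pmf_bounded[where B = B]) (simp add: norm_mult B)
  also have "\<dots> = measure_pmf.expectation (H n) (\<lambda>l. cis (s * real_of_int (hd l)) * tilted_op s w (take L (increments l)))"
  proof (intro integral_cong_AE)
    show "AE l in H n. measure_pmf.expectation (map_pmf (\<lambda>z. z # l) (walk_kernel L p q l)) ?h
        = cis (s * real_of_int (hd l)) * tilted_op s w (take L (increments l))"
    proof (rule AE_pmfI)
      fix l assume l: "l \<in> set_pmf (H n)"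
      have len: "length l = Suc n" and nn: "nn_path l"
        using l length_set_history_pmf set_history_walk_kernel unfolding H_def by blast+
      have "walk_kernel L p q l = map_pmf (\<lambda>up. if up then hd l + 1 else hd l - 1)
          (bernoulli_pmf (incr_up_prob p q (take L (increments l))))"
        unfolding walk_kernel_def using up_prob_eq_incr_up_prob[of L l p q] len nn n L by simp
      moreover have "take L (increments (z # l)) = (z - hd l) # butlast (take L (increments l))" for z
        using len n L by (intro take_increments_Cons) auto
      moreover have "cis (s * real_of_int (hd l) - s) = cis (s * real_of_int (hd l)) * cis (- s)"
        by (simp add: cis_mult)
      ultimately show "measure_pmf.expectation (map_pmf (\<lambda>z. z # l) (walk_kernel L p q l)) ?h
          = cis (s * real_of_int (hd l)) * tilted_op s w (take L (increments l))"
        using incr_up_prob_bounds[of "take L (increments l)"]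
        by (simp add: tilted_op_def expectation_bernoulli_complex cis_mult[symmetric] algebra_simps)
    qed
  qed auto
  finally show ?thesis .
qed

text \<open>Write \<open>f\<close> for \<open>first_coord\<close> minus \<open>m\<close>. Then
  \<open>f + g\<close> and \<open>h - f^2/2 - f g\<close> are the coefficients of \<open>i s\<close>
  and \<open>s^2\<close> in \<open>cis (s f) (1 + i s g + s^2 h)\<close>; the equations make
  \<open>P\<close> send them to the corresponding coefficients \<open>g\<close> and
  \<open>h - v/2\<close> of \<open>(1 - v s^2/2) (1 + i s g + s^2 h)\<close>. The sign of
  \<open>v\<close> is left open.\<close>

context
  fixes g h :: "int list \<Rightarrow> real" and B m v :: real
  assumes bounded: "\<And>\<eta>. \<bar>g \<eta>\<bar> \<le> B" "\<And>\<eta>. \<bar>h \<eta>\<bar> \<le> B"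
    and poisson_g: "\<And>\<eta>. \<eta> \<in> S \<Longrightarrow> P (\<lambda>\<eta>. (first_coord \<eta> - m) + g \<eta>) \<eta> = g \<eta>"
    and poisson_h: "\<And>\<eta>. \<eta> \<in> S \<Longrightarrow>
      P (\<lambda>\<eta>. h \<eta> - (first_coord \<eta> - m)\<^sup>2 / 2 - (first_coord \<eta> - m) * g \<eta>) \<eta> = h \<eta> - v / 2"
begin

text \<open>The function \<open>w\<close> of the introduction; there \<open>Q\<^sub>s\<close> is \<open>cis (- s m) * tilted_op s\<close>.\<close>
definition corrector :: "real \<Rightarrow> int list \<Rightarrow> complex" where
  "corrector s \<eta> = 1 + \<i> * s * g \<eta> + s\<^sup>2 * h \<eta>"

text \<open>The constant of \<open>cis_mult_quadratic_approx\<close> with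
  \<open>C = 1 + \<bar>m\<bar>\<close>, which bounds a centred increment, plus
  \<open>\<bar>v\<bar> * B\<close> for the products of \<open>v * s^2 / 2\<close> with the
  nonconstant part of the corrector.\<close>

definition eigen_error :: real where
  "eigen_error = (1 + \<bar>m\<bar>) ^ 3 * (1 + 2 * B) + (1 + \<bar>m\<bar>) * B + (1 + \<bar>m\<bar>)\<^sup>2 * B + \<bar>v\<bar> * B"

lemma B_nonneg: "0 \<le> B" and eigen_error_nonneg: "0 \<le> eigen_error"
proof -
  show "0 \<le> B" using bounded(1)[of undefined] by linarith
  then show "0 \<le> eigen_error" by (simp add: eigen_error_def)
qed

lemma corrector_minus_1:
  assumes "\<bar>s\<bar> \<le> 1"
  shows "norm (corrector s \<eta> - 1) \<le> 2 * B * \<bar>s\<bar>"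
proof -
  have "norm (corrector s \<eta> - 1) \<le> \<bar>s\<bar> * \<bar>g \<eta>\<bar> + s\<^sup>2 * \<bar>h \<eta>\<bar>"
    unfolding corrector_def add.assoc add_diff_cancel_left'
    by (rule order.trans[OF norm_triangle_ineq]) (simp add: norm_mult norm_power)
  also have "\<dots> \<le> \<bar>s\<bar> * B + \<bar>s\<bar> * B"
  proof (intro add_mono mult_mono)
    show "s\<^sup>2 \<le> \<bar>s\<bar>" using assms mult_left_mono[of "\<bar>s\<bar>" 1 "\<bar>s\<bar>"] by (simp add: power2_eq_square)
  qed (auto simp: bounded B_nonneg)
  finally show ?thesis by simp
qed

lemma corrector_bounded:
  assumes "\<bar>s\<bar> \<le> 1"
  shows "norm (corrector s \<eta>) \<le> 1 + 2 * B"
proof -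
  have "norm (corrector s \<eta>) \<le> 1 + norm (corrector s \<eta> - 1)"
    using norm_triangle_ineq[of 1 "corrector s \<eta> - 1"] by simp
  also have "norm (corrector s \<eta> - 1) \<le> 2 * B * 1"
    using corrector_minus_1[OF assms, of \<eta>] mult_left_mono[OF assms, of "2 * B"] B_nonneg by linarith
  finally show ?thesis by simp
qed

text \<open>The two Poisson equations cancel the orders 1 and 2, so that only terms of order 3 and
  higher remain.\<close>

lemma corrector_approx_eigenvector:
  assumes s: "\<bar>s\<bar> \<le> 1" and \<eta>: "\<eta> \<in> S"
  shows "norm (cis (- s * m) * tilted_op s (corrector s) \<eta> - of_real (1 - v * s\<^sup>2 / 2) * corrector s \<eta>)
    \<le> eigen_error * \<bar>s\<bar> ^ 3"
proof -
  define u where "u = incr_up_prob p q \<eta>"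
  define c where "c b = of_int b - m" for b :: int
  define g' where "g' b = g (b # butlast \<eta>)" for b
  define h' where "h' b = h (b # butlast \<eta>)" for b
  define T where "T b = cis (s * c b) * (1 + \<i> * s * g' b + s\<^sup>2 * h' b)" for b
  define A where "A b = c b + g' b" for b
  define D where "D b = h' b - (c b)\<^sup>2 / 2 - c b * g' b" for b
  define K where "K = (1 + \<bar>m\<bar>) ^ 3 * (1 + 2 * B) + (1 + \<bar>m\<bar>) * B + (1 + \<bar>m\<bar>)\<^sup>2 * B"
  have u: "0 \<le> u" "u \<le> 1" unfolding u_def by (rule incr_up_prob_bounds)+
  have A: "g \<eta> = u * A 1 + (1 - u) * A (- 1)"
    using poisson_g[OF \<eta>] by (simp add: incr_op_def first_coord_def A_def c_def g'_def u_def)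
  have D: "h \<eta> = v / 2 + (u * D 1 + (1 - u) * D (- 1))"
    using poisson_h[OF \<eta>] by (simp add: incr_op_def first_coord_def D_def c_def g'_def h'_def u_def)
  have T: "norm (T b - (1 + \<i> * s * A b + s\<^sup>2 * D b)) \<le> K * \<bar>s\<bar> ^ 3" if "b = 1 \<or> b = - 1" for b
    using cis_mult_quadratic_approx[OF s, of "c b" "1 + \<bar>m\<bar>" "g' b" B "h' b"] that bounded
    by (auto simp: T_def A_def D_def K_def c_def g'_def h'_def)
  \<comment> \<open>The centring factor is absorbed into the phase: the increment \<open>b\<close>
    carries \<open>s * (b - m)\<close>.\<close>
  have "cis (- s * m) * tilted_op s (corrector s) \<eta> = of_real u * T 1 + of_real (1 - u) * T (- 1)"
  proof -
    have "cis (s * c 1) = cis (- s * m) * cis s" "cis (s * c (- 1)) = cis (- s * m) * cis (- s)"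
      unfolding cis_mult c_def by (simp_all add: algebra_simps)
    then show ?thesis
      by (simp add: tilted_op_def T_def corrector_def g'_def h'_def u_def algebra_simps)
  qed
  \<comment> \<open>The first bracket averages the Taylor errors; the last is
    \<open>v * s^2 / 2\<close> times \<open>corrector s \<eta> - 1\<close>.\<close>
  also have "\<dots> - of_real (1 - v * s\<^sup>2 / 2) * corrector s \<eta>
      = (of_real u * (T 1 - (1 + \<i> * s * A 1 + s\<^sup>2 * D 1))
        + of_real (1 - u) * (T (- 1) - (1 + \<i> * s * A (- 1) + s\<^sup>2 * D (- 1))))
        + (\<i> * (v * (s ^ 3 * g \<eta>) / 2) + v * (s ^ 3 * (s * h \<eta>)) / 2)"
  proof -
    have "of_real u * (1 + \<i> * s * A 1 + s\<^sup>2 * D 1) + of_real (1 - u) * (1 + \<i> * s * A (- 1) + s\<^sup>2 * D (- 1))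
        = 1 + \<i> * s * of_real (u * A 1 + (1 - u) * A (- 1)) + s\<^sup>2 * of_real (u * D 1 + (1 - u) * D (- 1))"
      by (simp add: algebra_simps)
    also have "\<dots> = 1 + \<i> * s * g \<eta> + s\<^sup>2 * (h \<eta> - v / 2)"
      using A D by simp
    also have "\<dots> = of_real (1 - v * s\<^sup>2 / 2) * corrector s \<eta>
        + (\<i> * (v * (s ^ 3 * g \<eta>) / 2) + v * (s ^ 3 * (s * h \<eta>)) / 2)"
      by (simp add: corrector_def algebra_simps power2_eq_square power3_eq_cube)
    finally show ?thesis by (simp add: algebra_simps)
  qed
  finally have "norm (cis (- s * m) * tilted_op s (corrector s) \<eta> - of_real (1 - v * s\<^sup>2 / 2) * corrector s \<eta>)
      \<le> (norm (of_real u * (T 1 - (1 + \<i> * s * A 1 + s\<^sup>2 * D 1)))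
        + norm (of_real (1 - u) * (T (- 1) - (1 + \<i> * s * A (- 1) + s\<^sup>2 * D (- 1)))))
        + (norm (\<i> * (v * (s ^ 3 * g \<eta>) / 2)) + norm (v * (s ^ 3 * (s * h \<eta>)) / 2 :: complex))"
    by (simp only:) (intro order.trans[OF norm_triangle_ineq] add_mono norm_triangle_ineq)
  also have "\<dots> \<le> (u * (K * \<bar>s\<bar> ^ 3) + (1 - u) * (K * \<bar>s\<bar> ^ 3))
      + (\<bar>v\<bar> * (\<bar>s\<bar> ^ 3 * B) / 2 + \<bar>v\<bar> * (\<bar>s\<bar> ^ 3 * (1 * B)) / 2)"
  proof (intro add_mono)
    show "norm (of_real u * (T 1 - (1 + \<i> * s * A 1 + s\<^sup>2 * D 1))) \<le> u * (K * \<bar>s\<bar> ^ 3)"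
      using u T[of 1] unfolding norm_mult by (intro mult_mono) auto
    show "norm (of_real (1 - u) * (T (- 1) - (1 + \<i> * s * A (- 1) + s\<^sup>2 * D (- 1)))) \<le> (1 - u) * (K * \<bar>s\<bar> ^ 3)"
      unfolding norm_mult
    proof (intro mult_mono)
      show "norm (of_real (1 - u) :: complex) \<le> 1 - u" using u by (simp only: norm_of_real)
    qed (use u T[of "- 1"] in auto)
    show "norm (\<i> * (v * (s ^ 3 * g \<eta>) / 2)) \<le> \<bar>v\<bar> * (\<bar>s\<bar> ^ 3 * B) / 2"
      using bounded by (auto simp: norm_mult norm_power norm_divide intro!: mult_left_mono divide_right_mono)
    have "\<bar>s\<bar> * \<bar>h \<eta>\<bar> \<le> 1 * B" using s bounded B_nonneg by (intro mult_mono) auto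
    then show "norm (v * (s ^ 3 * (s * h \<eta>)) / 2 :: complex) \<le> \<bar>v\<bar> * (\<bar>s\<bar> ^ 3 * (1 * B)) / 2"
      by (auto simp: norm_mult norm_power norm_divide intro!: mult_left_mono divide_right_mono)
  qed
  also have "\<dots> = eigen_error * \<bar>s\<bar> ^ 3"
    by (simp add: eigen_error_def K_def algebra_simps)
  finally show ?thesis .
qed

section \<open>Recursion and limit of the characteristic functions\<close>

context
  fixes \<mu> :: "int pmf"
begin

text \<open>The characteristic function of \<open>X n - n * m\<close> at \<open>s\<close> when
  \<open>X 0\<close> has law \<open>\<mu>\<close>.\<close>

definition walk_char :: "nat \<Rightarrow> real \<Rightarrow> complex" where
  "walk_char n s = cis (- s * m * n) *
    measure_pmf.expectation (history_pmf \<mu> (walk_kernel L p q) n) (\<lambda>l. cis (s * real_of_int (hd l)))"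

text \<open>Inserting the corrector costs an error of order \<open>s\<close>, but yields an almost
  exact geometric recursion in \<open>n\<close>.\<close>

definition corrected_char :: "real \<Rightarrow> nat \<Rightarrow> complex" where
  "corrected_char s n = cis (- s * m * n) *
    measure_pmf.expectation (history_pmf \<mu> (walk_kernel L p q) n)
      (\<lambda>l. cis (s * real_of_int (hd l)) * corrector s (take L (increments l)))"

lemma integrable_cis_mult_corrector:
  assumes "\<bar>s\<bar> \<le> 1"
  shows "integrable (measure_pmf \<nu>) (\<lambda>l. cis (f l) * corrector s (k l))"
  by (rule measure_pmf.integrable_const_bound[where B = "1 + 2 * B"])
    (auto simp: norm_mult corrector_bounded[OF assms])

lemma walk_char_minus_corrected:
  assumes s: "\<bar>s\<bar> \<le> 1"
  shows "norm (corrected_char s n - walk_char n s) \<le> 2 * B * \<bar>s\<bar>"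
proof -
  have int: "integrable (measure_pmf (history_pmf \<mu> (walk_kernel L p q) n)) (\<lambda>l. cis (s * real_of_int (hd l)))"
    by (rule measure_pmf.integrable_const_bound[where B = 1]) auto
  have "corrected_char s n - walk_char n s = cis (- s * m * n) *
    measure_pmf.expectation (history_pmf \<mu> (walk_kernel L p q) n)
      (\<lambda>l. cis (s * real_of_int (hd l)) * (corrector s (take L (increments l)) - 1))"
    unfolding corrected_char_def walk_char_def right_diff_distrib mult_1_right
    by (subst Bochner_Integration.integral_diff[OF integrable_cis_mult_corrector[OF s] int])
      (simp add: right_diff_distrib)
  also have "norm \<dots> \<le> 2 * B * \<bar>s\<bar>"
    unfolding norm_mult norm_cis mult_1
    by (rule norm_expectation_pmf_le) (simp add: norm_mult corrector_minus_1[OF s])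
  finally show ?thesis .
qed

text \<open>The approximate eigenvector relation is integrated after one application of
  \<open>expectation_walk_step\<close>; for \<open>n \<ge> L\<close> the window lies in
  \<open>S\<close>, where that relation holds.\<close>

lemma corrected_char_step:
  assumes s: "\<bar>s\<bar> \<le> 1" and n: "n \<ge> L"
  shows "norm (corrected_char s (Suc n) - of_real (1 - v * s\<^sup>2 / 2) * corrected_char s n)
    \<le> eigen_error * \<bar>s\<bar> ^ 3"
proof -
  let ?H = "history_pmf \<mu> (walk_kernel L p q)"
  define z :: complex where "z = of_real (1 - v * s\<^sup>2 / 2)"
  let ?\<eta> = "\<lambda>l. take L (increments l)"
  have bnd: "norm (tilted_op s (corrector s) \<eta>) \<le> 2 * (1 + 2 * B)" for \<eta>
  proof -
    have "norm (tilted_op s (corrector s) \<eta>)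
        \<le> norm (of_real (incr_up_prob p q \<eta>) * cis s * corrector s (1 # butlast \<eta>))
        + norm (of_real (1 - incr_up_prob p q \<eta>) * cis (- s) * corrector s (- 1 # butlast \<eta>))"
      unfolding tilted_op_def by (rule norm_triangle_ineq)
    also have "\<dots> \<le> 1 * (1 + 2 * B) + 1 * (1 + 2 * B)"
      unfolding norm_mult norm_cis mult_1_right norm_of_real
      using incr_up_prob_bounds[of \<eta>]
      by (intro add_mono mult_mono corrector_bounded[OF s]) auto
    finally show ?thesis by simp
  qed
  have int1: "integrable (measure_pmf (?H n)) (\<lambda>l. cis (- s * m) * (cis (s * real_of_int (hd l)) * tilted_op s (corrector s) (?\<eta> l)))"
    by (rule measure_pmf.integrable_const_bound[where B = "2 * (1 + 2 * B)"]) (auto simp: norm_mult intro!: AE_I2 bnd[simplified])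
  have int2: "integrable (measure_pmf (?H n)) (\<lambda>l. z * (cis (s * real_of_int (hd l)) * corrector s (?\<eta> l)))"
    by (intro integrable_mult_right integrable_cis_mult_corrector s)
  have "corrected_char s (Suc n) = cis (- s * m * n) * (cis (- s * m) *
      measure_pmf.expectation (?H n) (\<lambda>l. cis (s * real_of_int (hd l)) * tilted_op s (corrector s) (?\<eta> l)))"
    unfolding corrected_char_def expectation_walk_step[of "corrector s", OF corrector_bounded[OF s] n]
      mult.assoc[symmetric] cis_mult
    by (simp add: algebra_simps)
  then have "corrected_char s (Suc n) - z * corrected_char s n = cis (- s * m * n) *
      (measure_pmf.expectation (?H n) (\<lambda>l. cis (- s * m) * (cis (s * real_of_int (hd l)) * tilted_op s (corrector s) (?\<eta> l)))
        - measure_pmf.expectation (?H n) (\<lambda>l. z * (cis (s * real_of_int (hd l)) * corrector s (?\<eta> l))))"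
    unfolding integral_mult_right_zero corrected_char_def
    by (simp only: right_diff_distrib mult.left_commute)
  also have "\<dots> = cis (- s * m * n) * measure_pmf.expectation (?H n)
      (\<lambda>l. cis (s * real_of_int (hd l)) * (cis (- s * m) * tilted_op s (corrector s) (?\<eta> l) - z * corrector s (?\<eta> l)))"
    by (subst Bochner_Integration.integral_diff[OF int1 int2, symmetric]) (simp add: algebra_simps)
  also have "norm \<dots> \<le> eigen_error * \<bar>s\<bar> ^ 3"
    unfolding norm_mult norm_cis mult_1
    by (rule norm_expectation_pmf_le)
      (use n in \<open>simp only: z_def norm_mult norm_cis mult_1 corrector_approx_eigenvector[OF s] take_increments_in_states\<close>)
  finally show ?thesis by (simp only: z_def)
qed

text \<open>The time is fixed at \<open>L\<close>, so continuity of a characteristic function at 0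
  suffices, with no moment condition on \<open>X 0\<close>.\<close>

lemma tendsto_corrected_char_0:
  assumes "(s \<longlongrightarrow> 0) F"
  shows "((\<lambda>n. corrected_char (s n) L) \<longlongrightarrow> 1) F"
proof -
  define D where "D = distr (history_pmf \<mu> (walk_kernel L p q) L) borel (\<lambda>l. real_of_int (hd l))"
  have "real_distribution D"
    by (auto simp: D_def real_distribution_def real_distribution_axioms_def intro: measure_pmf.prob_space_distr)
  then interpret D: real_distribution D .
  have ch: "walk_char L x = cis (- x * m * L) * char D x" for x
    unfolding walk_char_def char_def D_def by (subst integral_distr) (auto simp: cis_conv_exp)
  have "((\<lambda>n. char D (s n)) \<longlongrightarrow> char D 0) F"
    by (rule isCont_tendsto_compose[OF D.isCont_char assms])
  moreover have "((\<lambda>n. cis (- s n * m * L)) \<longlongrightarrow> cis (- 0 * m * L)) F"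
    by (intro tendsto_intros assms)
  ultimately have walk: "((\<lambda>n. walk_char L (s n)) \<longlongrightarrow> 1) F"
    unfolding ch using tendsto_mult[of "\<lambda>n. cis (- s n * m * L)" _ F "\<lambda>n. char D (s n)"]
    by (fastforce simp: D.char_zero)
  have "\<forall>\<^sub>F n in F. norm (corrected_char (s n) L - walk_char L (s n)) \<le> 2 * B * \<bar>s n\<bar>"
  proof -
    have "\<forall>\<^sub>F n in F. \<bar>s n\<bar> < 1" using tendsto_rabs_zero[OF assms] by (rule order_tendstoD) simp
    then show ?thesis by eventually_elim (simp add: walk_char_minus_corrected)
  qed
  moreover have "((\<lambda>n. 2 * B * \<bar>s n\<bar>) \<longlongrightarrow> 0) F"
    using tendsto_mult[OF tendsto_const[of "2 * B"] tendsto_rabs_zero[OF assms]] by simp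
  ultimately have "((\<lambda>n. corrected_char (s n) L - walk_char L (s n)) \<longlongrightarrow> 0) F"
    by (rule Lim_null_comparison)
  from tendsto_add[OF this walk] show ?thesis by simp
qed

text \<open>With \<open>s\<close> of order \<open>1 / sqrt n\<close>, about \<open>n\<close> errors
  of order \<open>s^3\<close> sum to order \<open>1 / sqrt n\<close>, while the exact powers of
  \<open>1 - v t^2 / (2 n)\<close> tend to the Gaussian factor.\<close>

lemma walk_char_tendsto:
  "(\<lambda>n. walk_char n (t / sqrt n)) \<longlonglongrightarrow> of_real (exp (- v * t\<^sup>2 / 2))"
proof -
  define s where "s n = t / sqrt (real n)" for n
  \<comment> \<open>The absolute value makes \<open>r n\<close> at least 1 and a bound for
    \<open>norm (z n)\<close> whatever the sign of \<open>v\<close>.\<close>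
  define r where "r n = 1 + \<bar>v\<bar> * (s n)\<^sup>2 / 2" for n
  define z :: "nat \<Rightarrow> complex" where "z n = of_real (1 - v * (s n)\<^sup>2 / 2)" for n
  have s0: "s \<longlonglongrightarrow> 0" unfolding s_def by real_asymp
  have s2: "(s n)\<^sup>2 = t\<^sup>2 / n" for n by (simp add: s_def power_divide)
  have r: "1 \<le> r n" for n by (simp add: r_def)
  have z: "norm (z n) \<le> r n" for n
  proof -
    have "norm (z n) = \<bar>1 - v * (s n)\<^sup>2 / 2\<bar>" unfolding z_def by (rule norm_of_real)
    also have "\<dots> \<le> 1 + \<bar>v * (s n)\<^sup>2 / 2\<bar>" by linarith
    finally show ?thesis by (simp add: r_def abs_mult)
  qed
  \<comment> \<open>The amplification of errors stays bounded in \<open>n\<close>, by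
    \<open>1 + y \<le> exp y\<close>.\<close>
  have rn: "r n ^ (n - L) \<le> exp (\<bar>v\<bar> * t\<^sup>2 / 2)" if "n > 0" for n
  proof -
    have "r n ^ (n - L) \<le> r n ^ n" using r by (intro power_increasing) auto
    also have "\<dots> \<le> exp (\<bar>v\<bar> * (s n)\<^sup>2 / 2) ^ n"
      unfolding r_def by (intro power_mono exp_ge_add_one_self) simp
    also have "\<dots> = exp (\<bar>v\<bar> * t\<^sup>2 / 2)"
      using that by (simp add: exp_of_nat_mult[symmetric] s2)
    finally show ?thesis .
  qed
  \<comment> \<open>Accumulated recursion errors, plus the cost of removing the corrector at time
    \<open>n\<close>.\<close>
  define e where "e n = real n * (eigen_error * \<bar>s n\<bar> ^ 3) * exp (\<bar>v\<bar> * t\<^sup>2 / 2) + 2 * B * \<bar>s n\<bar>" for n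
  have "e \<longlonglongrightarrow> 0"
  proof -
    have "(\<lambda>n. real n * (1 / sqrt n) ^ 3) \<longlonglongrightarrow> 0" by real_asymp
    from tendsto_mult[OF tendsto_const[of "\<bar>t\<bar> ^ 3"] this]
    have "(\<lambda>n. real n * \<bar>s n\<bar> ^ 3) \<longlonglongrightarrow> 0"
      by (simp add: s_def power_divide mult_ac)
    from tendsto_add[OF tendsto_mult[OF tendsto_const[of "eigen_error * exp (\<bar>v\<bar> * t\<^sup>2 / 2)"] this]
        tendsto_mult[OF tendsto_const[of "2 * B"] tendsto_rabs_zero[OF s0]]]
    show ?thesis by (simp add: e_def[abs_def] mult_ac)
  qed
  moreover have "\<forall>\<^sub>F n in sequentially. norm (walk_char n (s n) - z n ^ (n - L) * corrected_char (s n) L) \<le> e n"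
  proof -
    have "\<forall>\<^sub>F n in sequentially. \<bar>s n\<bar> < 1"
      using tendsto_rabs_zero[OF s0] by (rule order_tendstoD) simp
    with eventually_gt_at_top[of L] show ?thesis
    proof eventually_elim
      case (elim n)
      have "norm (walk_char n (s n) - z n ^ (n - L) * corrected_char (s n) L)
          \<le> norm (corrected_char (s n) n - z n ^ (n - L) * corrected_char (s n) L)
            + norm (corrected_char (s n) n - walk_char n (s n))"
        using norm_triangle_ineq4[of "corrected_char (s n) n - z n ^ (n - L) * corrected_char (s n) L"
            "corrected_char (s n) n - walk_char n (s n)"] by simp
      also have "norm (corrected_char (s n) n - walk_char n (s n)) \<le> 2 * B * \<bar>s n\<bar>"
        using elim by (intro walk_char_minus_corrected) auto
      also have "norm (corrected_char (s n) n - z n ^ (n - L) * corrected_char (s n) L)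
          \<le> real (n - L) * (eigen_error * \<bar>s n\<bar> ^ 3) * r n ^ (n - L)"
      proof -
        have "norm (corrected_char (s n) (L + (n - L)) - z n ^ (n - L) * corrected_char (s n) L)
            \<le> real (n - L) * (eigen_error * \<bar>s n\<bar> ^ 3) * r n ^ (n - L)"
        proof (rule approximate_geometric_bound)
          show "norm (corrected_char (s n) (Suc k) - z n * corrected_char (s n) k) \<le> eigen_error * \<bar>s n\<bar> ^ 3"
            if "k \<ge> L" for k
            unfolding z_def using elim that by (intro corrected_char_step) auto
        qed (use z r eigen_error_nonneg in auto)
        then show ?thesis using elim by simp
      qed
      also have "\<dots> \<le> real n * (eigen_error * \<bar>s n\<bar> ^ 3) * exp (\<bar>v\<bar> * t\<^sup>2 / 2)"
        using elim r[of n] eigen_error_nonneg rn[of n] by (intro mult_mono) auto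
      finally show ?case by (simp add: e_def)
    qed
  qed
  ultimately have "(\<lambda>n. walk_char n (s n) - z n ^ (n - L) * corrected_char (s n) L) \<longlonglongrightarrow> 0"
    by (rule Lim_null_comparison[rotated])
  moreover have "(\<lambda>n. z n ^ (n - L) * corrected_char (s n) L) \<longlonglongrightarrow> of_real (exp (- v * t\<^sup>2 / 2)) * 1"
  proof (intro tendsto_mult tendsto_corrected_char_0 s0)
    have "z n ^ (n - L) = of_real ((1 + (- v * t\<^sup>2 / 2) / real n) ^ (n - L))" for n
      unfolding z_def s2 by (simp add: mult.commute)
    moreover have "(\<lambda>n. complex_of_real ((1 + (- v * t\<^sup>2 / 2) / real n) ^ (n - L)))
        \<longlonglongrightarrow> of_real (exp (- v * t\<^sup>2 / 2))"
      by (intro tendsto_of_real tendsto_one_plus_div_power)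
    ultimately show "(\<lambda>n. z n ^ (n - L)) \<longlonglongrightarrow> complex_of_real (exp (- v * t\<^sup>2 / 2))"
      by (simp only:)
  qed
  ultimately show ?thesis using tendsto_add by (fastforce simp: s_def)
qed

end
end
end

section \<open>Choice of the Poisson solutions and passage to the weak limit\<close>

theorem theorem3:
  fixes p q :: real and L :: nat
    and M :: "'a measure" and X :: "nat \<Rightarrow> 'a \<Rightarrow> int"
    and \<pi> :: "int list pmf"
    and N :: "'b measure" and Y :: "nat \<Rightarrow> 'b \<Rightarrow> int list"
  assumes "0 < p" "p < 1" "0 < q" "q < 1" "L \<ge> 1"
    and "perturbed_walk M L p q X"
    and "stationary_distribution L p q \<pi>"
    and "increment_chain N p q \<pi> Y"
  shows "\<exists>C \<sigma>2.
      (\<lambda>m. \<Sum>k=1..m+1. covariance_of N (\<lambda>\<omega>. first_coord (Y 1 \<omega>)) (\<lambda>\<omega>. first_coord (Y (k+1) \<omega>)))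
        \<longlonglongrightarrow> C \<and>
      \<sigma>2 = prob_space.variance N (\<lambda>\<omega>. first_coord (Y 1 \<omega>)) + 2 * C \<and>
      \<sigma>2 \<ge> 0 \<and>
      weak_conv_m
        (\<lambda>n. distr M borel (\<lambda>\<omega>. (real_of_int (X n \<omega>) - real n * drift p q \<pi>) / sqrt (real n)))
        (centered_normal \<sigma>2)"
proof -
  interpret incr_params p q L using assms by unfold_locales auto
  interpret M: perturbed_walk M L p q X by fact
  note \<pi> = assms(7)
  note [simp] = integrable_stationary[OF \<pi>]
  let ?E = "measure_pmf.expectation \<pi>"
  define m where "m = drift p q \<pi>"
  define f where "f \<eta> = first_coord \<eta> - m" for \<eta>
  have cov: "covariance_of N (\<lambda>\<omega>. first_coord (Y 1 \<omega>)) (\<lambda>\<omega>. first_coord (Y (k + 1) \<omega>))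
      = ?E (\<lambda>\<eta>. f \<eta> * (P ^^ k) f \<eta>)" for k
    using covariance_increment_chain[OF \<pi> assms(8), of k] by (simp add: f_def[abs_def] m_def)
  have Ef: "?E f = 0"
    using expectation_first_coord[OF \<pi>] by (simp add: f_def[abs_def] m_def)
  \<comment> \<open>Solving for \<open>P f\<close> instead of \<open>f\<close> makes the series
    start at lag 1, as the covariance sum does.\<close>
  then have "?E (P f) = 0" by (simp add: expectation_incr_op[OF \<pi>])
  then obtain g where g: "\<And>\<eta>. \<eta> \<in> S \<Longrightarrow> (\<lambda>k. (P ^^ k) (P f) \<eta>) sums g \<eta>"
    "\<And>\<eta>. \<eta> \<in> S \<Longrightarrow> P g \<eta> = g \<eta> - P f \<eta>" "\<And>\<eta>. \<eta> \<notin> S \<Longrightarrow> g \<eta> = 0"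
    by (rule poisson_equation[OF \<pi>]) blast
  define C where "C = ?E (\<lambda>\<eta>. f \<eta> * g \<eta>)"
  define v where "v = prob_space.variance N (\<lambda>\<omega>. first_coord (Y 1 \<omega>)) + 2 * C"
  \<comment> \<open>Lag 0 in \<open>cov\<close> is the variance.\<close>
  have v: "v = ?E (\<lambda>\<eta>. (f \<eta>)\<^sup>2) + 2 * C"
    using cov[of 0] by (simp add: v_def covariance_of_def power2_eq_square)
  have C: "(\<lambda>m. \<Sum>k=1..m+1. covariance_of N (\<lambda>\<omega>. first_coord (Y 1 \<omega>)) (\<lambda>\<omega>. first_coord (Y (k+1) \<omega>)))
      \<longlonglongrightarrow> C"
  proof -
    \<comment> \<open>After a shift of the lag by one, the partial sum becomes a finite sum over
      states, so the limit can be taken state by state.\<close>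
    have "(\<Sum>k=1..m+1. covariance_of N (\<lambda>\<omega>. first_coord (Y 1 \<omega>)) (\<lambda>\<omega>. first_coord (Y (k+1) \<omega>)))
        = (\<Sum>\<eta>\<in>S. f \<eta> * (\<Sum>k\<le>m. (P ^^ k) (P f) \<eta>) * pmf \<pi> \<eta>)" for m
    proof -
      have "(\<Sum>k=1..m+1. covariance_of N (\<lambda>\<omega>. first_coord (Y 1 \<omega>)) (\<lambda>\<omega>. first_coord (Y (k+1) \<omega>)))
          = (\<Sum>k\<in>Suc ` {..m}. ?E (\<lambda>\<eta>. f \<eta> * (P ^^ k) f \<eta>))"
        unfolding cov by (rule sum.cong) (simp_all add: image_Suc_atMost)
      also have "\<dots> = (\<Sum>k\<le>m. ?E (\<lambda>\<eta>. f \<eta> * (P ^^ k) (P f) \<eta>))"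
        by (simp add: sum.reindex funpow_swap1)
      also have "\<dots> = ?E (\<lambda>\<eta>. f \<eta> * (\<Sum>k\<le>m. (P ^^ k) (P f) \<eta>))"
        by (simp add: sum_distrib_left)
      finally show ?thesis by (simp add: expectation_stationary_sum[OF \<pi>])
    qed
    moreover have "(\<lambda>m. \<Sum>\<eta>\<in>S. f \<eta> * (\<Sum>k\<le>m. (P ^^ k) (P f) \<eta>) * pmf \<pi> \<eta>)
        \<longlonglongrightarrow> (\<Sum>\<eta>\<in>S. f \<eta> * g \<eta> * pmf \<pi> \<eta>)"
      using g(1) by (intro tendsto_intros) (auto simp: sums_def_le)
    ultimately show ?thesis by (simp add: C_def expectation_stationary_sum[OF \<pi>])
  qed
  \<comment> \<open>By the formula for \<open>v\<close>, the subtracted function has mean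
    \<open>v / 2\<close>, so \<open>\<phi>\<close> is centred and the second equation
    solvable.\<close>
  define \<phi> where "\<phi> \<eta> = v / 2 - P (\<lambda>\<eta>. (f \<eta>)\<^sup>2 / 2 + f \<eta> * g \<eta>) \<eta>" for \<eta>
  have "?E \<phi> = 0"
    using expectation_incr_op[OF \<pi>, of "\<lambda>\<eta>. (f \<eta>)\<^sup>2 / 2 + f \<eta> * g \<eta>"]
    by (simp add: \<phi>_def[abs_def] v C_def)
  then obtain h where h: "\<And>\<eta>. \<eta> \<in> S \<Longrightarrow> P h \<eta> = h \<eta> - \<phi> \<eta>" "\<And>\<eta>. \<eta> \<notin> S \<Longrightarrow> h \<eta> = 0"
    by (rule poisson_equation[OF \<pi>]) blast
  define B where "B = (\<Sum>\<eta>\<in>S. \<bar>g \<eta>\<bar> + \<bar>h \<eta>\<bar>)"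
  have B: "\<bar>g \<eta>\<bar> \<le> B" "\<bar>h \<eta>\<bar> \<le> B" for \<eta>
  proof -
    have "\<bar>g \<eta>\<bar> + \<bar>h \<eta>\<bar> \<le> B"
    proof (cases "\<eta> \<in> S")
      case True
      then show ?thesis unfolding B_def by (intro member_le_sum) auto
    next
      case False
      then show ?thesis using g(3) h(2) by (simp add: B_def sum_nonneg)
    qed
    then show "\<bar>g \<eta>\<bar> \<le> B" "\<bar>h \<eta>\<bar> \<le> B" by linarith+
  qed
  have pg: "P (\<lambda>\<eta>. (first_coord \<eta> - m) + g \<eta>) \<eta> = g \<eta>" if "\<eta> \<in> S" for \<eta>
    using g(2)[OF that] by (simp add: incr_op_def f_def algebra_simps)
  have ph: "P (\<lambda>\<eta>. h \<eta> - (first_coord \<eta> - m)\<^sup>2 / 2 - (first_coord \<eta> - m) * g \<eta>) \<eta> = h \<eta> - v / 2"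
    if "\<eta> \<in> S" for \<eta>
    using h(1)[OF that] unfolding \<phi>_def f_def[symmetric] by (simp add: incr_op_def algebra_simps)
  obtain \<mu> where \<mu>: "\<And>z. M.prob {\<omega> \<in> space M. X 0 \<omega> = z} = pmf \<mu> z"
    using M.pmf_of_countable_rv[OF M.X_measurable[of 0]] by blast
  define D where "D n = distr M borel (\<lambda>\<omega>. (real_of_int (X n \<omega>) - real n * m) / sqrt (real n))" for n
  have rv [measurable]: "(\<lambda>\<omega>. (real_of_int (X n \<omega>) - real n * m) / sqrt (real n)) \<in> borel_measurable M" for n
    by (rule measurable_compose[OF M.X_measurable]) simp
  have D: "real_distribution (D n)" for n
    by (auto simp: D_def real_distribution_def real_distribution_axioms_def intro: M.prob_space_distr)
  \<comment> \<open>At \<open>n = 0\<close> both quotients by \<open>sqrt 0\<close> are 0, so the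
    identity holds there too.\<close>
  have char_D: "char (D n) t = walk_char m \<mu> n (t / sqrt n)" for n t
  proof -
    let ?s = "t / sqrt n"
    have iexp: "iexp (t * ((x - real n * m) / sqrt (real n))) = cis (- ?s * m * n) * cis (?s * x)" for x :: real
      unfolding cis_mult unfolding cis_conv_exp
      by (rule arg_cong[where f = "\<lambda>y. iexp y"]) (simp add: algebra_simps diff_divide_distrib)
    have "char (D n) t = (LINT \<omega>|M. iexp (t * ((real_of_int (X n \<omega>) - real n * m) / sqrt (real n))))"
      unfolding char_def D_def by (rule integral_distr) (use rv in simp_all)
    also have "\<dots> = (LINT \<omega>|M. cis (- ?s * m * n) * cis (?s * real_of_int (X n \<omega>)))"
      unfolding iexp ..
    also have "\<dots> = cis (- ?s * m * n) * (LINT \<omega>|M. cis (?s * real_of_int (hd (history X n \<omega>))))"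
      by (cases n) simp_all
    also have "(LINT \<omega>|M. cis (?s * real_of_int (hd (history X n \<omega>))))
        = (LINT l|distr M (count_space UNIV) (history X n). cis (?s * real_of_int (hd l)))"
      by (subst integral_distr[OF measurable_history[OF M.X_measurable]]) auto
    also have "distr M (count_space UNIV) (history X n) = history_pmf \<mu> (walk_kernel L p q) n"
      using p q by (intro M.distr_walk_history \<mu>) auto
    finally show ?thesis by (simp add: walk_char_def[OF B pg ph])
  qed
  have lim: "(\<lambda>n. char (D n) t) \<longlonglongrightarrow> of_real (exp (- v * t\<^sup>2 / 2))" for t
    unfolding char_D by (rule walk_char_tendsto[OF B pg ph])
  \<comment> \<open>At \<open>t = 1\<close> the limit \<open>exp (- v / 2)\<close> is at most 1,
    which forces \<open>v \<ge> 0\<close> before the normal law is introduced.\<close>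
  have "norm (complex_of_real (exp (- v * 1\<^sup>2 / 2))) \<le> 1"
    by (rule Lim_norm_ubound[OF _ lim]) (auto intro!: always_eventually real_distribution.cmod_char_le_1 D)
  then have v0: "v \<ge> 0" by simp
  have "weak_conv_m D (centered_normal v)"
    using lim by (intro levy_continuity D) (simp_all add: char_centered_normal v0)
  with C v0 show ?thesis
    unfolding D_def[abs_def] m_def v_def by blast
qed

end
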